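(* Let $\gamma>-1$ be real. For every integer $n\ge 0$, the weighted poly-Bergman space $$H^{2,\gamma}_n(\mathbb{D})=\{F\in L^{2,\gamma}(\mathbb{D});\ \partial_{\bar z}^{\,n+1}F=0\}$$ is a closed subspace of $L^{2,\gamma}(\mathbb{D})$. Moreover, it coincides with the closed linear span in $L^{2,\gamma}(\mathbb{D})$ of the disc polynomials $\mathcal{R}^{\gamma}_{m,k}$ with $m=0,1,2,\dots$ and $k=0,1,\dots,n$, that is, $$H^{2,\gamma}_n(\mathbb{D})=\overline{\mathrm{Span}\{\mathcal{R}^{\gamma}_{m,k};\ m=0,1,2,\dots,\ k=0,1,\dots,n\}}^{\,L^{2,\gamma}(\mathbb{D})}.$$
   Context: $\mathbb{D}=\{z\in\mathbb{C}:|z|<1\}$ is the open unit disc. For real $\gamma>-1$, $L^{2,\gamma}(\mathbb{D})=L^2(\mathbb{D},d\mu_\gamma)$ is the Hilbert space of complex-valued functions on $\mathbb{D}$ square integrable for the measure $d\mu_\gamma(z)=(1-|z|^2)^{\gamma}\,dx\,dy$, $z=x+iy$, with scalar product $\langle f,g\rangle_\gamma=\int_{\mathbb{D}}f\,\overline{g}\,d\mu_\gamma$. $\partial_{\bar z}=\frac12\left(\frac{\partial}{\partial x}+i\frac{\partial}{\partial y}\right)$ is the Wirtinger operator. A function $F$ with $\partial_{\bar z}^{\,n+1}F=0$ on $\mathbb{D}$ is called polyanalytic of order $n+1$; equivalently $F(z)=\sum_{j=0}^{n}\bar z^{\,j}\varphi_j(z)$ with $\varphi_j$ holomorphic in $\mathbb{D}$.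 For nonnegative integers $m,n$ the disc polynomial is $$\mathcal{R}^{\gamma}_{m,n}(z,\bar z)=\frac{z^m\bar z^n}{|z|^{2(m\wedge n)}}\,P^{(\gamma,|m-n|)}_{m\wedge n}(2|z|^2-1),\qquad m\wedge n=\min(m,n),$$ where $P^{(\alpha,\beta)}_{k}$ is the Jacobi polynomial of degree $k$ normalized by $P^{(\alpha,\beta)}_k(1)=1$ (the prefactor is understood as the monomial $z^{m-m\wedge n}\,\bar z^{\,n-m\wedge n}$). Explicitly, $$\mathcal{R}^{\gamma}_{m,n}(z,\bar z)=m!\,n!\sum_{j=0}^{m\wedge n}\frac{(-1)^j(1-z\bar z)^j}{j!\,(\gamma+1)_j}\,\frac{z^{m-j}}{(m-j)!}\,\frac{\bar z^{\,n-j}}{(n-j)!},$$ where $(a)_0=1$ and $(a)_k=a(a+1)\cdots(a+k-1)$. *)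

theory Defs
  imports "HOL-Analysis.Analysis" "HOL-Library.Function_Algebras"
begin

abbreviation unit_disc :: "complex set" (\<open>\<D>\<close>) where
  "\<D> \<equiv> ball 0 1"

section \<open>The weighted space of square integrable functions\<close>

text \<open>
  Elements of the Hilbert space are represented by functions on the complex plane; since the
  measure lives on the disc, the values outside the disc are irrelevant.  Functions that agree
  almost everywhere are not identified, so \<open>L2_norm\<close> is a seminorm on \<open>L2\<close> and \<open>L2_topology\<close> is
  the corresponding seminorm topology.  Its closed sets are invariant under modification on null
  sets, and are exactly the preimages of the closed sets of the quotient by almost everywhere
  equality.
\<close>

definition disc_measure :: "real \<Rightarrow> complex measure" (\<open>\<mu>\<close>) where
  "\<mu> \<gamma> = density (lebesgue_on \<D>) (\<lambda>z. ennreal ((1 - (norm z)\<^sup>2) powr \<gamma>))"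

definition L2 :: "real \<Rightarrow> (complex \<Rightarrow> complex) set" where
  "L2 \<gamma> = {f \<in> borel_measurable (\<mu> \<gamma>). integrable (\<mu> \<gamma>) (\<lambda>z. (norm (f z))\<^sup>2)}"

definition L2_inner :: "real \<Rightarrow> (complex \<Rightarrow> complex) \<Rightarrow> (complex \<Rightarrow> complex) \<Rightarrow> complex" where
  "L2_inner \<gamma> f g = (\<integral>z. f z * cnj (g z) \<partial>\<mu> \<gamma>)"

definition L2_norm :: "real \<Rightarrow> (complex \<Rightarrow> complex) \<Rightarrow> real" where
  "L2_norm \<gamma> f = sqrt (Re (L2_inner \<gamma> f f))"

definition L2_ball :: "real \<Rightarrow> (complex \<Rightarrow> complex) \<Rightarrow> real \<Rightarrow> (complex \<Rightarrow> complex) set" where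
  "L2_ball \<gamma> f r = {g \<in> L2 \<gamma>. L2_norm \<gamma> (g - f) < r}"

definition L2_topology :: "real \<Rightarrow> (complex \<Rightarrow> complex) topology" where
  "L2_topology \<gamma> = topology_generated_by {L2_ball \<gamma> f r | f r. f \<in> L2 \<gamma> \<and> 0 < r}"

lemma topspace_L2_topology: "topspace (L2_topology \<gamma>) = L2 \<gamma>"
proof -
  let ?B = "{L2_ball \<gamma> f r | f r. f \<in> L2 \<gamma> \<and> 0 < r}"
  have "\<Union> ?B \<subseteq> L2 \<gamma>"
    by (auto simp: L2_ball_def)
  moreover have "f \<in> \<Union> ?B" if "f \<in> L2 \<gamma>" for f
  proof
    show "f \<in> L2_ball \<gamma> f 1"
      using that by (simp add: L2_ball_def L2_norm_def L2_inner_def)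
    show "L2_ball \<gamma> f 1 \<in> ?B"
      using that zero_less_one by blast
  qed
  ultimately show ?thesis
    unfolding L2_topology_def topology_generated_by_topspace by blast
qed

section \<open>Complex-linear structure on functions\<close>

definition cscale :: "complex \<Rightarrow> (complex \<Rightarrow> complex) \<Rightarrow> complex \<Rightarrow> complex" where
  "cscale c f = (\<lambda>z. c * f z)"

interpretation cfun: vector_space cscale
  by unfold_locales (auto simp: cscale_def fun_eq_iff algebra_simps)

section \<open>Polyanalytic functions\<close>

text \<open>Derivatives are over the reals: \<open>1\<close> is the \<open>x\<close>-direction and \<open>\<i>\<close> is the \<open>y\<close>-direction.\<close>

definition wirtinger_bar :: "(complex \<Rightarrow> complex) \<Rightarrow> complex \<Rightarrow> complex" where
  "wirtinger_bar f z =
     (frechet_derivative f (at z) 1 + \<i> * frechet_derivative f (at z) \<i>) / 2"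

text \<open>
  The differentiability condition says that all derivatives involved really exist; without it
  \<open>frechet_derivative\<close> is unspecified.  It is real differentiability, not holomorphy.
\<close>

definition polyanalytic_on :: "nat \<Rightarrow> (complex \<Rightarrow> complex) \<Rightarrow> complex set \<Rightarrow> bool" where
  "polyanalytic_on k F S \<longleftrightarrow>
     (\<forall>j<k. \<forall>z\<in>S. (wirtinger_bar ^^ j) F differentiable (at z)) \<and>
     (\<forall>z\<in>S. (wirtinger_bar ^^ k) F z = 0)"

text \<open>As an element of the Hilbert space, \<open>F\<close> satisfies the equation if some representative of
  its almost everywhere class does.\<close>

definition poly_bergman :: "real \<Rightarrow> nat \<Rightarrow> (complex \<Rightarrow> complex) set" where
  "poly_bergman \<gamma> n =
     {F \<in> L2 \<gamma>. \<exists>G. polyanalytic_on (n + 1) G \<D> \<and> (AE z in \<mu> \<gamma>. F z = G z)}"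

section \<open>Disc polynomials\<close>

text \<open>Jacobi polynomials in their classical normalization (Szego, (4.3.2)).\<close>

definition jacobi :: "real \<Rightarrow> real \<Rightarrow> nat \<Rightarrow> real \<Rightarrow> real" where
  "jacobi \<alpha> \<beta> k x =
     (\<Sum>s\<le>k. ((real k + \<alpha>) gchoose (k - s)) * ((real k + \<beta>) gchoose s)
              * ((x - 1) / 2) ^ s * ((x + 1) / 2) ^ (k - s))"

definition jacobi_normalized :: "real \<Rightarrow> real \<Rightarrow> nat \<Rightarrow> real \<Rightarrow> real" where
  "jacobi_normalized \<alpha> \<beta> k x = jacobi \<alpha> \<beta> k x / jacobi \<alpha> \<beta> k 1"

definition disc_poly :: "real \<Rightarrow> nat \<Rightarrow> nat \<Rightarrow> complex \<Rightarrow> complex" where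
  "disc_poly \<gamma> m n z =
     z ^ (m - min m n) * cnj z ^ (n - min m n)
     * of_real (jacobi_normalized \<gamma> \<bar>real m - real n\<bar> (min m n) (2 * (norm z)\<^sup>2 - 1))"

lemma jacobi_1: "jacobi \<alpha> \<beta> k 1 = (real k + \<alpha>) gchoose k"
proof -
  have "jacobi \<alpha> \<beta> k 1 = (\<Sum>s\<in>{0}. ((real k + \<alpha>) gchoose (k - s)) * ((real k + \<beta>) gchoose s)
              * ((1 - 1) / 2) ^ s * ((1 + 1) / 2) ^ (k - s))"
    unfolding jacobi_def by (rule sum.mono_neutral_right) auto
  then show ?thesis by simp
qed

lemma gchoose_pochhammer:
  assumes "s \<le> k"
  shows "((real k + \<alpha>) gchoose (k - s)) * fact (k - s) * pochhammer (\<alpha> + 1) s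
         = pochhammer (\<alpha> + 1) k"
proof -
  have "((real k + \<alpha>) gchoose (k - s)) = pochhammer (\<alpha> + 1 + real s) (k - s) / fact (k - s)"
    using assms by (simp add: gbinomial_pochhammer' of_nat_diff algebra_simps)
  then show ?thesis
    using pochhammer_product[OF assms, of "\<alpha> + 1"] by simp
qed

lemma jacobi_1_pos:
  assumes "\<alpha> > -1"
  shows "jacobi \<alpha> \<beta> k 1 > 0"
proof -
  have "((real k + \<alpha>) gchoose k) = pochhammer (\<alpha> + 1) k / fact k"
    using gchoose_pochhammer[of 0 k \<alpha>] by (simp add: field_simps)
  moreover have "pochhammer (\<alpha> + 1) k > 0"
    using assms by (intro pochhammer_pos) simp
  ultimately show ?thesis
    by (simp add: jacobi_1)
qed

lemma jacobi_normalized_1: "\<alpha> > -1 \<Longrightarrow> jacobi_normalized \<alpha> \<beta> k 1 = 1"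
  using jacobi_1_pos[of \<alpha> \<beta> k] by (simp add: jacobi_normalized_def)

lemma jacobi_normalized_explicit:
  assumes "\<alpha> > -1"
  shows "jacobi_normalized \<alpha> (real b) k x =
     (\<Sum>j\<le>k. (-1) ^ j * fact k * fact (k + b) / (fact j * pochhammer (\<alpha> + 1) j)
        * ((1 - x) / 2) ^ j / (fact (k - j) * fact (k + b - j)) * ((1 + x) / 2) ^ (k - j))"
proof -
  have "((real k + \<alpha>) gchoose (k - j)) * ((real k + real b) gchoose j)
              * ((x - 1) / 2) ^ j * ((x + 1) / 2) ^ (k - j) / ((real k + \<alpha>) gchoose k)
     = (-1) ^ j * fact k * fact (k + b) / (fact j * pochhammer (\<alpha> + 1) j)
        * ((1 - x) / 2) ^ j / (fact (k - j) * fact (k + b - j)) * ((1 + x) / 2) ^ (k - j)"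
    if "j \<le> k" for j
  proof -
    have p: "pochhammer (\<alpha> + 1) i > 0" for i
      using assms by (intro pochhammer_pos) simp
    have 1: "((real k + \<alpha>) gchoose (k - j))
        = pochhammer (\<alpha> + 1) k / (fact (k - j) * pochhammer (\<alpha> + 1) j)"
      using gchoose_pochhammer[OF that, of \<alpha>] p[of j] by (simp add: field_simps)
    have 2: "((real k + \<alpha>) gchoose k) = pochhammer (\<alpha> + 1) k / fact k"
      using gchoose_pochhammer[of 0 k \<alpha>] by (simp add: field_simps)
    have 3: "((real k + real b) gchoose j) = fact (k + b) / (fact j * fact (k + b - j))"
      using binomial_fact[of j "k + b", where 'a = real] that
      by (simp add: binomial_gbinomial)
    have 4: "((x - 1) / 2) ^ j = (-1) ^ j * ((1 - x) / 2) ^ j"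
      by (simp flip: power_mult_distrib)
    show ?thesis
      unfolding 1 2 3 4 using p[of k] p[of j] by (simp add: field_simps)
  qed
  then show ?thesis
    unfolding jacobi_normalized_def jacobi_1 unfolding jacobi_def sum_divide_distrib
    by (intro sum.cong) auto
qed

lemma disc_poly_explicit:
  assumes "\<gamma> > -1"
  shows "disc_poly \<gamma> m n z =
    fact m * fact n * (\<Sum>j\<le>min m n. (-1) ^ j * (1 - z * cnj z) ^ j
        / (fact j * of_real (pochhammer (\<gamma> + 1) j))
        * (z ^ (m - j) / fact (m - j)) * (cnj z ^ (n - j) / fact (n - j)))"
proof -
  define k where "k = min m n"
  define b where "b = max m n - min m n"
  define r where "r = (norm z)\<^sup>2"
  have r: "complex_of_real r = z * cnj z"
    unfolding r_def by (rule complex_norm_square)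
  have b: "\<bar>real m - real n\<bar> = real b"
    by (auto simp: b_def max_def min_def of_nat_diff)
  have f: "fact (k + b - j) * fact (k - j) = (fact (m - j) * fact (n - j) :: complex)" for j
    by (auto simp: b_def k_def max_def min_def)
  have f0: "fact (k + b) * fact k = (fact m * fact n :: complex)"
    using f[of 0] by simp
  have z: "z ^ (m - k) * cnj z ^ (n - k) * (z * cnj z) ^ (k - j) = z ^ (m - j) * cnj z ^ (n - j)"
    if "j \<le> k" for j
  proof -
    have "m - j = (m - k) + (k - j)" "n - j = (n - k) + (k - j)"
      using that by (auto simp: k_def)
    then show ?thesis by (simp only: power_add power_mult_distrib mult_ac)
  qed
  have h: "(1 - (2 * r - 1)) / 2 = 1 - r" "(1 + (2 * r - 1)) / 2 = r"
    by (auto simp: field_simps)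
  have "disc_poly \<gamma> m n z = z ^ (m - k) * cnj z ^ (n - k) * (\<Sum>j\<le>k. (-1) ^ j
        * (fact (k + b) * fact k) / (fact j * of_real (pochhammer (\<gamma> + 1) j))
        * (1 - z * cnj z) ^ j / (fact (k + b - j) * fact (k - j)) * (z * cnj z) ^ (k - j))"
    unfolding disc_poly_def b k_def[symmetric] r_def[symmetric]
      jacobi_normalized_explicit[OF assms] h
    by (simp add: r[symmetric] mult_ac)
  also have "\<dots> = (\<Sum>j\<le>k. (-1) ^ j
        * (fact m * fact n) / (fact j * of_real (pochhammer (\<gamma> + 1) j))
        * (1 - z * cnj z) ^ j / (fact (m - j) * fact (n - j))
        * (z ^ (m - k) * cnj z ^ (n - k) * (z * cnj z) ^ (k - j)))"
    unfolding f f0 sum_distrib_left by (intro sum.cong) (auto simp: mult_ac)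
  also have "\<dots> = fact m * fact n * (\<Sum>j\<le>k. (-1) ^ j * (1 - z * cnj z) ^ j
        / (fact j * of_real (pochhammer (\<gamma> + 1) j))
        * (z ^ (m - j) / fact (m - j)) * (cnj z ^ (n - j) / fact (n - j)))"
    unfolding sum_distrib_left
    by (intro sum.cong refl, simp only: atMost_iff z) (simp add: mult_ac)
  finally show ?thesis by (simp add: k_def)
qed

end

theory Submission
  imports Defs "HOL-Complex_Analysis.Complex_Analysis"
begin

text \<open>
  A function is polyanalytic of order \<open>n + 1\<close> on the disc iff it is \<open>\<Sum>j\<le>n. cnj z ^ j * \<phi> j z\<close> with
  holomorphic \<open>\<phi> j\<close>.  Recentring at \<open>z0\<close> leaves the top coefficient unchanged, and by rotation
  invariance integration of \<open>u ^ n * F (z0 + u)\<close> over a small disc picks out \<open>\<phi> n z0\<close>; peeling off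
  one coefficient after the other, all \<open>\<phi> j\<close> are bounded on compact sets by the \<open>L\<^sup>2\<close> norm of \<open>F\<close>.
  Hence \<open>L\<^sup>2\<close> convergence forces locally uniform convergence of the coefficients, and the space is closed.

  The disc polynomials with \<open>k \<le> n\<close> span the monomials \<open>z ^ m * cnj z ^ k\<close> with \<open>k \<le> n\<close>, the change
  of basis being triangular.  For density, truncate the Taylor series of \<open>\<phi> j\<close> at degree \<open>N + j\<close>,
  so that exactly the angular modes \<open>\<le> N\<close> of \<open>F\<close> are kept.  Different modes are orthogonal
  on every disc of radius \<open>R \<le> 1\<close> around \<open>0\<close>, so the truncations have increasing norms bounded by that of
  \<open>F\<close>, hence are Cauchy in \<open>L\<^sup>2\<close>, and Fatou's lemma identifies their limit with \<open>F\<close>.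
\<close>

section \<open>The seminorm and its topology\<close>

text \<open>Two obstacles shape the argument. The summands \<open>cnj z ^ j * \<phi> j z\<close> of
  a square integrable function need not be square integrable themselves, since they can cancel near
  the boundary: \<open>(1 - z * cnj z) * g z\<close> may lie in the space although \<open>g\<close>
  does not. So the coefficients cannot be approximated in norm one at a time; the truncation has to
  act on all of them together, and the angular mode \<open>m - j\<close> of
  \<open>z ^ m * cnj z ^ j\<close> is the grading that a radial weight respects. For the same reason
  the bounds on coefficients are local, and each peeling step gives up part of the radius. Functions
  are not identified almost everywhere, so a limit has to be exhibited as an actual function. In
  both limit arguments it is first found pointwise inside the disc, and Fatou's lemma then converts
  norm bounds along the sequence into a norm bound for the limit.\<close>

lemma L2_norm_eq: "L2_norm \<gamma> f = sqrt (\<integral>z. (norm (f z))\<^sup>2 \<partial>\<mu> \<gamma>)"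
proof -
  have "L2_inner \<gamma> f f = (\<integral>z. complex_of_real ((norm (f z))\<^sup>2) \<partial>\<mu> \<gamma>)"
    unfolding L2_inner_def by (intro Bochner_Integration.integral_cong refl)
      (simp add: complex_norm_square del: of_real_power)
  then show ?thesis by (simp add: L2_norm_def del: of_real_power)
qed

lemma L2_norm_nonneg: "L2_norm \<gamma> f \<ge> 0"
  by (simp add: L2_norm_eq)

lemma L2_norm_power2: "(L2_norm \<gamma> f)\<^sup>2 = (\<integral>z. (norm (f z))\<^sup>2 \<partial>\<mu> \<gamma>)"
  by (simp add: L2_norm_eq)

lemma L2_norm_minus_commute: "L2_norm \<gamma> (f - g) = L2_norm \<gamma> (g - f)"
  by (simp add: L2_norm_eq norm_minus_commute)

text \<open>Young's inequality, from \<open>(b * u - a * v)\<^sup>2 \<ge> 0\<close>. The weights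
  stay free so that they can be tuned to the norms of the two summands.\<close>

lemma power2_norm_add_le:
  fixes x y :: "'a::real_normed_vector"
  assumes "a > 0" "b > 0"
  shows "(norm (x + y))\<^sup>2 \<le> (1 + b / a) * (norm x)\<^sup>2 + (1 + a / b) * (norm y)\<^sup>2"
proof -
  define u v where "u = norm x" and "v = norm y"
  have "(norm (x + y))\<^sup>2 \<le> (u + v)\<^sup>2"
    by (simp add: u_def v_def norm_triangle_ineq power_mono)
  also have "\<dots> \<le> (1 + b / a) * u\<^sup>2 + (1 + a / b) * v\<^sup>2"
  proof -
    have "0 \<le> (b * u - a * v)\<^sup>2 / (a * b)" using assms by simp
    also have "\<dots> = (1 + b / a) * u\<^sup>2 + (1 + a / b) * v\<^sup>2 - (u + v)\<^sup>2"
      using assms by (simp add: field_simps power2_eq_square)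
    finally show ?thesis by simp
  qed
  finally show ?thesis by (simp add: u_def v_def)
qed

lemma L2_add:
  assumes "f \<in> L2 \<gamma>" "g \<in> L2 \<gamma>"
  shows "f + g \<in> L2 \<gamma>"
proof -
  have [measurable]: "f \<in> borel_measurable (\<mu> \<gamma>)" "g \<in> borel_measurable (\<mu> \<gamma>)"
    using assms by (auto simp: L2_def)
  have "integrable (\<mu> \<gamma>) (\<lambda>z. (norm ((f + g) z))\<^sup>2)"
  proof (rule Bochner_Integration.integrable_bound)
    show "integrable (\<mu> \<gamma>) (\<lambda>z. 2 * (norm (f z))\<^sup>2 + 2 * (norm (g z))\<^sup>2)"
      using assms by (auto simp: L2_def)
    show "AE z in \<mu> \<gamma>. norm ((norm ((f + g) z))\<^sup>2) \<le> norm (2 * (norm (f z))\<^sup>2 + 2 * (norm (g z))\<^sup>2)"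
      using power2_norm_add_le[of 1 1] by auto
  qed (unfold plus_fun_def, measurable)
  then show ?thesis by (simp add: L2_def plus_fun_def)
qed

lemma L2_cscale:
  assumes "f \<in> L2 \<gamma>"
  shows "cscale c f \<in> L2 \<gamma>"
  using assms by (auto simp: L2_def cscale_def norm_mult power_mult_distrib)

lemma L2_zero: "0 \<in> L2 \<gamma>"
  by (simp add: L2_def zero_fun_def)

lemma L2_subspace: "cfun.subspace (L2 \<gamma>)"
  by (simp add: cfun.subspace_def L2_add L2_cscale L2_zero)

lemma L2_diff: "f \<in> L2 \<gamma> \<Longrightarrow> g \<in> L2 \<gamma> \<Longrightarrow> f - g \<in> L2 \<gamma>"
  by (rule cfun.subspace_diff[OF L2_subspace])

text \<open>Integrating the weighted inequality with \<open>a\<close> and \<open>b\<close> equal to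
  the two norms would give exactly \<open>(a + b)\<^sup>2\<close> on the right.\<close>

lemma L2_norm_triangle:
  assumes f: "f \<in> L2 \<gamma>" and g: "g \<in> L2 \<gamma>"
  shows "L2_norm \<gamma> (f + g) \<le> L2_norm \<gamma> f + L2_norm \<gamma> g"
proof (rule field_le_epsilon)
  fix e :: real assume "e > 0"
  \<comment> \<open>Half of \<open>e\<close> is added to each norm because a norm may be 0 and both
    numbers occur as denominators.\<close>
  define a where "a = L2_norm \<gamma> f + e / 2"
  define b where "b = L2_norm \<gamma> g + e / 2"
  have pos: "a > 0" "b > 0"
    using \<open>e > 0\<close> L2_norm_nonneg[of \<gamma> f] L2_norm_nonneg[of \<gamma> g] by (auto simp: a_def b_def)
  have int: "integrable (\<mu> \<gamma>) (\<lambda>z. (norm (f z))\<^sup>2)" "integrable (\<mu> \<gamma>) (\<lambda>z. (norm (g z))\<^sup>2)"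
    "integrable (\<mu> \<gamma>) (\<lambda>z. (norm ((f + g) z))\<^sup>2)"
    using f g L2_add[OF f g] by (auto simp: L2_def)
  have "(L2_norm \<gamma> (f + g))\<^sup>2
      \<le> (\<integral>z. (1 + b / a) * (norm (f z))\<^sup>2 + (1 + a / b) * (norm (g z))\<^sup>2 \<partial>\<mu> \<gamma>)"
    unfolding L2_norm_power2 using int power2_norm_add_le[OF pos]
    by (intro integral_mono) (auto simp del: distrib_right_numeral)
  also have "\<dots> = (1 + b / a) * (L2_norm \<gamma> f)\<^sup>2 + (1 + a / b) * (L2_norm \<gamma> g)\<^sup>2"
    using int by (simp add: L2_norm_power2)
  also have "\<dots> \<le> (1 + b / a) * a\<^sup>2 + (1 + a / b) * b\<^sup>2"
    using pos \<open>e > 0\<close> L2_norm_nonneg[of \<gamma> f] L2_norm_nonneg[of \<gamma> g]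
    by (intro add_mono mult_left_mono power_mono) (auto simp: a_def b_def)
  also have "\<dots> = (a + b)\<^sup>2"
  proof -
    have "b / a * a\<^sup>2 = a * b" "a / b * b\<^sup>2 = a * b"
      using pos by (simp_all add: power2_eq_square)
    then show ?thesis unfolding distrib_right power2_sum by linarith
  qed
  finally have "(L2_norm \<gamma> (f + g))\<^sup>2 \<le> (a + b)\<^sup>2" .
  then have "L2_norm \<gamma> (f + g) \<le> a + b"
    by (rule power2_le_imp_le) (use pos in simp)
  then show "L2_norm \<gamma> (f + g) \<le> L2_norm \<gamma> f + L2_norm \<gamma> g + e"
    by (simp add: a_def b_def)
qed

lemma L2_norm_triangle_diff:
  assumes "f \<in> L2 \<gamma>" "g \<in> L2 \<gamma>" "h \<in> L2 \<gamma>"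
  shows "L2_norm \<gamma> (f - h) \<le> L2_norm \<gamma> (f - g) + L2_norm \<gamma> (g - h)"
  using L2_norm_triangle[of "f - g" \<gamma> "g - h"] assms by (simp add: L2_diff)

text \<open>By definition the balls are only a subbasis. The triangle inequality puts a ball around
  each point of a ball, and this survives finite intersections and unions, so the balls form a
  basis.\<close>

lemma L2_topology_openD:
  assumes "openin (L2_topology \<gamma>) U" "f \<in> U"
  shows "f \<in> L2 \<gamma> \<and> (\<exists>r>0. L2_ball \<gamma> f r \<subseteq> U)"
proof -
  have "generate_topology_on {L2_ball \<gamma> f r | f r. f \<in> L2 \<gamma> \<and> 0 < r} U"
    using assms(1) unfolding L2_topology_def by (simp add: openin_topology_generated_by)
  then show ?thesis using assms(2)
  proof (induction arbitrary: f)
    case (Int U V)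
    then obtain r s where "r > 0" "s > 0" "L2_ball \<gamma> f r \<subseteq> U" "L2_ball \<gamma> f s \<subseteq> V" "f \<in> L2 \<gamma>"
      by (metis IntD1 IntD2)
    then show ?case
      by (intro conjI exI[of _ "min r s"]) (auto simp: L2_ball_def)
  next
    case (UN K)
    then show ?case by (meson Sup_upper UnionE order_trans)
  next
    case (Basis V)
    then obtain g r where V: "V = L2_ball \<gamma> g r" "g \<in> L2 \<gamma>" by auto
    then have f: "f \<in> L2 \<gamma>" "L2_norm \<gamma> (f - g) < r"
      using Basis by (auto simp: L2_ball_def)
    have "L2_ball \<gamma> f (r - L2_norm \<gamma> (f - g)) \<subseteq> V"
      using L2_norm_triangle_diff[OF _ f(1) V(2)] unfolding V(1) L2_ball_def by force
    then show ?case using f by (intro conjI exI[of _ "r - L2_norm \<gamma> (f - g)"]) auto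
  qed auto
qed

lemma L2_topology_closure_of:
  "L2_topology \<gamma> closure_of S =
    {f \<in> L2 \<gamma>. \<forall>r>0. \<exists>g\<in>S. g \<in> L2 \<gamma> \<and> L2_norm \<gamma> (g - f) < r}"
proof (intro equalityI subsetI)
  fix f assume f: "f \<in> L2_topology \<gamma> closure_of S"
  then have f2: "f \<in> L2 \<gamma>"
    by (simp add: in_closure_of topspace_L2_topology)
  have "\<exists>g\<in>S. g \<in> L2 \<gamma> \<and> L2_norm \<gamma> (g - f) < r" if "r > 0" for r
  proof -
    have "openin (L2_topology \<gamma>) (L2_ball \<gamma> f r)"
      unfolding L2_topology_def using f2 that by (intro topology_generated_by_Basis) auto
    moreover have "f \<in> L2_ball \<gamma> f r"
      using f2 that by (simp add: L2_ball_def L2_norm_eq)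
    ultimately obtain g where "g \<in> S" "g \<in> L2_ball \<gamma> f r"
      using f unfolding in_closure_of by meson
    then show ?thesis by (auto simp: L2_ball_def)
  qed
  with f2 show "f \<in> {f \<in> L2 \<gamma>. \<forall>r>0. \<exists>g\<in>S. g \<in> L2 \<gamma> \<and> L2_norm \<gamma> (g - f) < r}" by auto
next
  fix f assume f: "f \<in> {f \<in> L2 \<gamma>. \<forall>r>0. \<exists>g\<in>S. g \<in> L2 \<gamma> \<and> L2_norm \<gamma> (g - f) < r}"
  have "\<exists>g. g \<in> S \<and> g \<in> U" if U: "f \<in> U" "openin (L2_topology \<gamma>) U" for U
  proof -
    obtain r where "r > 0" "L2_ball \<gamma> f r \<subseteq> U" using L2_topology_openD[OF U(2,1)] by blast
    moreover then obtain g where "g \<in> S" "g \<in> L2 \<gamma>" "L2_norm \<gamma> (g - f) < r" using f by blast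
    ultimately show ?thesis by (auto simp: L2_ball_def)
  qed
  with f show "f \<in> L2_topology \<gamma> closure_of S"
    unfolding in_closure_of topspace_L2_topology by blast
qed

section \<open>Polyanalytic functions\<close>

lemma wirtinger_bar_eq:
  assumes "(f has_derivative f') (at z)"
  shows "wirtinger_bar f z = (f' 1 + \<i> * f' \<i>) / 2"
  using frechet_derivative_at[OF assms] by (simp add: wirtinger_bar_def)

lemma differentiable_transform_open:
  assumes "f differentiable at z" "open S" "z \<in> S" "\<And>w. w \<in> S \<Longrightarrow> f w = g w"
  shows "g differentiable at z"
  using assms has_derivative_transform_within_open unfolding differentiable_def by metis

lemma wirtinger_bar_cong_open:
  assumes "f differentiable at z" "open S" "z \<in> S" "\<And>w. w \<in> S \<Longrightarrow> f w = g w"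
  shows "wirtinger_bar g z = wirtinger_bar f z"
proof -
  obtain f' where f': "(f has_derivative f') (at z)"
    using assms(1) unfolding differentiable_def by blast
  from has_derivative_transform_within_open[OF f' assms(2-4)]
  show ?thesis using f' by (simp add: wirtinger_bar_eq)
qed

text \<open>These are the Cauchy-Riemann equations: the vanishing says
  \<open>f' \<i> = \<i> * f' 1\<close>, so the real-linear derivative is multiplication by
  \<open>f' 1\<close>.\<close>

lemma holomorphic_on_iff_wirtinger_bar:
  assumes "open S"
  shows "f holomorphic_on S \<longleftrightarrow> (\<forall>z\<in>S. f differentiable at z \<and> wirtinger_bar f z = 0)"
proof (intro iffI ballI)
  fix z assume "f holomorphic_on S" "z \<in> S"
  then have "f field_differentiable at z"
    using assms holomorphic_on_imp_differentiable_at by blast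
  then obtain d where d: "(f has_derivative (*) d) (at z)"
    by (auto simp: field_differentiable_def has_field_derivative_def)
  show "f differentiable at z \<and> wirtinger_bar f z = 0"
  proof
    show "f differentiable at z" unfolding differentiable_def using d by blast
    have "\<i> * (d * \<i>) = - d" by (simp add: complex_eq_iff)
    then show "wirtinger_bar f z = 0" unfolding wirtinger_bar_eq[OF d] by simp
  qed
next
  assume *: "\<forall>z\<in>S. f differentiable at z \<and> wirtinger_bar f z = 0"
  have "f field_differentiable at z" if "z \<in> S" for z
  proof -
    from * that have "f differentiable at z" by blast
    then obtain f' where f': "(f has_derivative f') (at z)"
      unfolding differentiable_def by blast
    then interpret f': linear f' by (rule has_derivative_linear)
    have "f' 1 + \<i> * f' \<i> = 0" using wirtinger_bar_eq[OF f'] * that by auto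
    then have "f' 1 = - (\<i> * f' \<i>)" by (simp add: eq_neg_iff_add_eq_0)
    then have i: "f' \<i> = \<i> * f' 1" by (simp add: mult.assoc[symmetric])
    have "f' h = f' 1 * h" for h
    proof -
      have "f' (Re h *\<^sub>R 1 + Im h *\<^sub>R \<i>) = Re h *\<^sub>R f' 1 + Im h *\<^sub>R (\<i> * f' 1)"
        by (simp only: f'.add f'.scaleR i)
      also have "Re h *\<^sub>R 1 + Im h *\<^sub>R \<i> = h" by (simp add: complex_eq_iff)
      also have "Re h *\<^sub>R f' 1 + Im h *\<^sub>R (\<i> * f' 1) = f' 1 * h"
        by (subst (5) complex_eq) (simp add: scaleR_conv_of_real algebra_simps)
      finally show ?thesis .
    qed
    then have "f' = (*) (f' 1)" by (rule ext)
    with f' have "(f has_field_derivative f' 1) (at z)"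
      unfolding has_field_derivative_def by argo
    then show ?thesis
      by (auto simp: field_differentiable_def)
  qed
  then show "f holomorphic_on S"
    using assms by (simp add: holomorphic_on_open field_differentiable_def)
qed

section \<open>Decomposition of polyanalytic functions into holomorphic coefficients\<close>

lemma polyanalytic_on_0: "polyanalytic_on 0 F S \<longleftrightarrow> (\<forall>z\<in>S. F z = 0)"
  by (simp add: polyanalytic_on_def)

text \<open>Strips the innermost operator, so inductions on the order pass from \<open>F\<close> to
  \<open>wirtinger_bar F\<close> and have to generalise \<open>F\<close>.\<close>

lemma polyanalytic_on_Suc:
  "polyanalytic_on (Suc k) F S \<longleftrightarrow>
    (\<forall>z\<in>S. F differentiable at z) \<and> polyanalytic_on k (wirtinger_bar F) S"
  unfolding polyanalytic_on_def All_less_Suc2 funpow_Suc_right o_apply funpow_0 by blast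

text \<open>\<open>cnj\<close> is real linear, hence its own derivative; the rest is the product
  rule. At \<open>j = 0\<close> the truncated exponent \<open>j - 1\<close> is harmless because of
  the factor \<open>of_nat j\<close>.\<close>

lemma has_derivative_cnj_power_mult:
  assumes "(\<phi> has_field_derivative d) (at z)"
  shows "((\<lambda>w. cnj w ^ j * \<phi> w) has_derivative
    (\<lambda>h. cnj z ^ j * (d * h) + of_nat j * cnj z ^ (j - 1) * cnj h * \<phi> z)) (at z)"
proof -
  have "((\<lambda>w. w ^ j) has_field_derivative of_nat j * cnj z ^ (j - 1)) (at (cnj z))"
    by (auto intro!: derivative_eq_intros)
  then have "((\<lambda>w. w ^ j) \<circ> cnj has_derivative (\<lambda>h. of_nat j * cnj z ^ (j - 1) * h) \<circ> cnj) (at z)"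
    by (intro diff_chain_at bounded_linear_imp_has_derivative bounded_linear_cnj)
      (simp add: has_field_derivative_def)
  from has_derivative_mult[OF this] assms show ?thesis
    by (auto simp: o_def has_field_derivative_def)
qed

text \<open>The combination \<open>f' 1 + \<i> * f' \<i>\<close> vanishes for the complex-linear
  terms \<open>deriv (\<phi> j) z * h\<close> and equals 2 for \<open>cnj h\<close>, so only the
  powers of \<open>cnj z\<close> get differentiated.\<close>

lemma wirtinger_bar_sum_cnj_power:
  assumes "open S" "\<And>j. j \<in> A \<Longrightarrow> \<phi> j holomorphic_on S" "z \<in> S"
  shows "(\<lambda>w. \<Sum>j\<in>A. cnj w ^ j * \<phi> j w) differentiable at z"
    and "wirtinger_bar (\<lambda>w. \<Sum>j\<in>A. cnj w ^ j * \<phi> j w) z =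
           (\<Sum>j\<in>A. of_nat j * cnj z ^ (j - 1) * \<phi> j z)"
proof -
  have "(\<phi> j has_field_derivative deriv (\<phi> j) z) (at z)" if "j \<in> A" for j
    using assms that holomorphic_derivI by blast
  then have *: "((\<lambda>w. \<Sum>j\<in>A. cnj w ^ j * \<phi> j w) has_derivative (\<lambda>h. \<Sum>j\<in>A.
      cnj z ^ j * (deriv (\<phi> j) z * h) + of_nat j * cnj z ^ (j - 1) * cnj h * \<phi> j z)) (at z)"
    by (intro has_derivative_sum has_derivative_cnj_power_mult)
  then show "(\<lambda>w. \<Sum>j\<in>A. cnj w ^ j * \<phi> j w) differentiable at z"
    by (auto simp: differentiable_def)
  show "wirtinger_bar (\<lambda>w. \<Sum>j\<in>A. cnj w ^ j * \<phi> j w) z =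
           (\<Sum>j\<in>A. of_nat j * cnj z ^ (j - 1) * \<phi> j z)"
    unfolding wirtinger_bar_eq[OF *]
    by (simp add: sum_distrib_left sum_divide_distrib flip: sum.distrib)
      (intro sum.cong refl, simp add: algebra_simps)
qed

text \<open>Differentiating shifts the coefficients to
  \<open>of_nat (Suc j) * \<phi> (Suc j)\<close> and shortens the sum by one, which drives the
  induction.\<close>

lemma polyanalytic_on_sum_cnj_power:
  assumes "open S" "\<And>j. j < k \<Longrightarrow> \<phi> j holomorphic_on S"
    and "\<And>z. z \<in> S \<Longrightarrow> F z = (\<Sum>j<k. cnj z ^ j * \<phi> j z)"
  shows "polyanalytic_on k F S"
  using assms(2,3)
proof (induction k arbitrary: F \<phi>)
  case 0
  then show ?case by (simp add: polyanalytic_on_0)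
next
  case (Suc k)
  let ?G = "\<lambda>z. \<Sum>j<Suc k. cnj z ^ j * \<phi> j z"
  have G: "?G differentiable at z"
    "wirtinger_bar ?G z = (\<Sum>j<Suc k. of_nat j * cnj z ^ (j - 1) * \<phi> j z)" if "z \<in> S" for z
    using Suc.prems(1) that assms(1) by (intro wirtinger_bar_sum_cnj_power; simp)+
  have eq: "?G z = F z" if "z \<in> S" for z
    using Suc.prems(2)[OF that] by (rule sym)
  \<comment> \<open>\<open>F\<close> equals \<open>?G\<close> only on \<open>S\<close>; openness of
    \<open>S\<close> lets the derivatives be transferred.\<close>
  have diff: "F differentiable at z" and wb: "wirtinger_bar F z = wirtinger_bar ?G z" if "z \<in> S" for z
    using differentiable_transform_open[OF G(1) assms(1) that eq]
      wirtinger_bar_cong_open[OF G(1) assms(1) that eq] that by blast+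
  have "polyanalytic_on k (wirtinger_bar F) S"
  proof (rule Suc.IH)
    show "(\<lambda>z. of_nat (Suc j) * \<phi> (Suc j) z) holomorphic_on S" if "j < k" for j
      using Suc.prems(1)[of "Suc j"] that by (intro holomorphic_intros) auto
    fix z assume z: "z \<in> S"
    have "wirtinger_bar F z = (\<Sum>j<Suc k. of_nat j * cnj z ^ (j - 1) * \<phi> j z)"
      unfolding wb[OF z] by (rule G(2)[OF z])
    then show "wirtinger_bar F z = (\<Sum>j<k. cnj z ^ j * (of_nat (Suc j) * \<phi> (Suc j) z))"
      unfolding sum.lessThan_Suc_shift by (simp add: mult_ac del: of_nat_Suc)
  qed
  with diff show ?case by (simp add: polyanalytic_on_Suc)
qed

text \<open>Integration in \<open>cnj z\<close>: a primitive \<open>P\<close> of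
  \<open>wirtinger_bar F\<close> is written down from the coefficients of the latter, and the
  constant of integration \<open>F - P\<close> is killed by \<open>wirtinger_bar\<close>, hence
  holomorphic.\<close>

lemma polyanalytic_onE:
  assumes "open S" "polyanalytic_on k F S"
  obtains \<phi> where "\<And>j. j < k \<Longrightarrow> \<phi> j holomorphic_on S"
    and "\<And>z. z \<in> S \<Longrightarrow> F z = (\<Sum>j<k. cnj z ^ j * \<phi> j z)"
  using assms(2)
proof (induction k arbitrary: F thesis)
  case 0
  then show ?case by (auto simp: polyanalytic_on_0)
next
  case (Suc k)
  then obtain \<phi> where hol: "\<And>j. j < k \<Longrightarrow> \<phi> j holomorphic_on S"
    and \<phi>: "\<And>z. z \<in> S \<Longrightarrow> wirtinger_bar F z = (\<Sum>j<k. cnj z ^ j * \<phi> j z)"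
    by (metis polyanalytic_on_Suc)
  \<comment> \<open>Coefficients of the formal primitive in \<open>cnj z\<close>; slot 0 stays empty
    for the constant of integration.\<close>
  define \<psi> where "\<psi> = (\<lambda>j z. if j = 0 then 0 else \<phi> (j - 1) z / of_nat j)"
  have hol\<psi>: "\<psi> j holomorphic_on S" if "j < Suc k" for j
    using that hol[of "j - 1"] unfolding \<psi>_def by (cases "j = 0") (auto intro!: holomorphic_intros)
  define P where "P = (\<lambda>z. \<Sum>j<Suc k. cnj z ^ j * \<psi> j z)"
  have P: "P differentiable at z" "wirtinger_bar P z = wirtinger_bar F z" if z: "z \<in> S" for z
  proof -
    show "P differentiable at z"
      unfolding P_def using hol\<psi> assms(1) z by (intro wirtinger_bar_sum_cnj_power) auto
    have "wirtinger_bar P z = (\<Sum>j<Suc k. of_nat j * cnj z ^ (j - 1) * \<psi> j z)"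
      unfolding P_def using hol\<psi> assms(1) z by (intro wirtinger_bar_sum_cnj_power) auto
    also have "\<dots> = (\<Sum>j<k. cnj z ^ j * \<phi> j z)"
      unfolding sum.lessThan_Suc_shift by (simp add: \<psi>_def field_simps del: of_nat_Suc)
    finally show "wirtinger_bar P z = wirtinger_bar F z" using \<phi>[OF z] by simp
  qed
  have F: "F differentiable at z" if "z \<in> S" for z
    using Suc.prems(2) that by (simp add: polyanalytic_on_Suc)
  have hol0: "(\<lambda>z. F z - P z) holomorphic_on S"
    unfolding holomorphic_on_iff_wirtinger_bar[OF assms(1)]
  proof
    fix z assume z: "z \<in> S"
    obtain f' where f': "(F has_derivative f') (at z)"
      using F[OF z] unfolding differentiable_def by blast
    obtain p' where p': "(P has_derivative p') (at z)"
      using P(1)[OF z] unfolding differentiable_def by blast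
    have "wirtinger_bar (\<lambda>z. F z - P z) z = wirtinger_bar F z - wirtinger_bar P z"
      unfolding wirtinger_bar_eq[OF f'] wirtinger_bar_eq[OF p']
        wirtinger_bar_eq[OF has_derivative_diff[OF f' p']]
      by (simp add: algebra_simps diff_divide_distrib add_divide_distrib)
    then have "wirtinger_bar (\<lambda>z. F z - P z) z = 0" using P(2)[OF z] by simp
    then show "(\<lambda>z. F z - P z) differentiable at z \<and> wirtinger_bar (\<lambda>z. F z - P z) z = 0"
      using has_derivative_diff[OF f' p'] by (auto simp: differentiable_def)
  qed
  define \<eta> where "\<eta> = (\<lambda>j. if j = 0 then (\<lambda>z. F z - P z) else \<psi> j)"
  show ?case
  proof (rule Suc.prems(1))
    show "\<eta> j holomorphic_on S" if "j < Suc k" for j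
      using hol0 hol\<psi>[OF that] by (simp add: \<eta>_def)
    show "F z = (\<Sum>j<Suc k. cnj z ^ j * \<eta> j z)" if "z \<in> S" for z
      unfolding sum.lessThan_Suc_shift P_def \<eta>_def by (simp add: sum.lessThan_Suc_shift \<psi>_def del: of_nat_Suc)
  qed
qed

section \<open>Rotation invariance\<close>

lemma pred_cball [measurable]: "Measurable.pred borel (\<lambda>x. x \<in> cball (c::'a::metric_space) r)"
  using borel_closed[OF closed_cball[of c r]] by (simp add: pred_def cball_def)

lemma borel_measurable_cnj [measurable]: "cnj \<in> borel_measurable borel"
  by (intro borel_measurable_continuous_onI continuous_intros)

lemma nn_integral_lborel_translate:
  fixes f :: "'a::euclidean_space \<Rightarrow> ennreal"
  assumes [measurable]: "f \<in> borel_measurable borel"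
  shows "(\<integral>\<^sup>+x. f (a + x) \<partial>lborel) = (\<integral>\<^sup>+x. f x \<partial>lborel)"
proof -
  have "(\<integral>\<^sup>+x. f x \<partial>lborel) = (\<integral>\<^sup>+x. f x \<partial>distr lborel borel ((+) a))"
    by (simp add: lborel_distr_plus)
  also have "\<dots> = (\<integral>\<^sup>+x. f (a + x) \<partial>lborel)"
    by (rule nn_integral_distr) measurable
  finally show ?thesis by simp
qed

text \<open>Both sides are translation invariant in \<open>f\<close> and the unit ball is rotation invariant: integrate
  \<open>f (c x)\<close> times the indicator of \<open>|y - c x| < 1\<close> over \<open>x\<close> and \<open>y\<close> in either order.\<close>

lemma nn_integral_lborel_rotation:
  fixes f :: "complex \<Rightarrow> ennreal"
  assumes [measurable]: "f \<in> borel_measurable borel" and c: "norm c = 1"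
  shows "(\<integral>\<^sup>+z. f (c * z) \<partial>lborel) = (\<integral>\<^sup>+z. f z \<partial>lborel)"
proof -
  define b :: "complex \<Rightarrow> ennreal" where "b = indicator (ball 0 1)"
  have [measurable]: "b \<in> borel_measurable borel" unfolding b_def by (intro borel_measurable_indicator) simp
  define k where "k = (\<integral>\<^sup>+z. b z \<partial>lborel)"
  have k: "k \<noteq> 0" "k \<noteq> top"
    by (simp_all add: k_def b_def emeasure_ball unit_ball_vol_2)
  have b: "b (c * z) = b z" "b (- z) = b z" for z
    using c by (simp_all add: b_def indicator_def norm_mult)
  have c0: "c \<noteq> 0" using c by auto
  have "(\<integral>\<^sup>+x. f (c * x) \<partial>lborel) * k = (\<integral>\<^sup>+x. f (c * x) * k \<partial>lborel)"
    by (rule nn_integral_multc[symmetric]) measurable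
  also have "\<dots> = (\<integral>\<^sup>+x. \<integral>\<^sup>+y. f (c * x) * b (- (c * x) + y) \<partial>lborel \<partial>lborel)"
    by (intro nn_integral_cong) (simp add: nn_integral_cmult nn_integral_lborel_translate k_def del: uminus_add_conv_diff)
  also have "\<dots> = (\<integral>\<^sup>+y. \<integral>\<^sup>+x. f (c * x) * b (- (c * x) + y) \<partial>lborel \<partial>lborel)"
    by (rule lborel_pair.Fubini'[symmetric]) measurable
  \<comment> \<open>Shifting \<open>x\<close> by \<open>y / c\<close> turns \<open>c * x\<close>
    into \<open>c * x + y\<close>, so that the indicator no longer depends on
    \<open>y\<close>.\<close>
  also have "\<dots> = (\<integral>\<^sup>+y. \<integral>\<^sup>+x. f (c * (y / c + x)) * b (- (c * (y / c + x)) + y) \<partial>lborel \<partial>lborel)"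
    by (intro nn_integral_cong nn_integral_lborel_translate[symmetric]) measurable
  also have "\<dots> = (\<integral>\<^sup>+y. \<integral>\<^sup>+x. f (c * x + y) * b x \<partial>lborel \<partial>lborel)"
  proof -
    have "c * (y / c + x) = c * x + y" for x y using c0 by (simp add: distrib_left)
    moreover have "- (c * x + y) + y = - (c * x)" for x y by simp
    ultimately show ?thesis by (simp only: b)
  qed
  also have "\<dots> = (\<integral>\<^sup>+x. \<integral>\<^sup>+y. f (c * x + y) * b x \<partial>lborel \<partial>lborel)"
    by (rule lborel_pair.Fubini') measurable
  also have "\<dots> = (\<integral>\<^sup>+x. (\<integral>\<^sup>+y. f y \<partial>lborel) * b x \<partial>lborel)"
    by (intro nn_integral_cong) (simp add: nn_integral_multc nn_integral_lborel_translate)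
  also have "\<dots> = (\<integral>\<^sup>+y. f y \<partial>lborel) * k"
    unfolding k_def by (rule nn_integral_cmult) measurable
  finally show ?thesis using k by (simp add: ennreal_mult_cancel_left mult.commute[of _ k])
qed

lemma lborel_distr_rotation:
  assumes "norm c = 1"
  shows "distr lborel borel ((*) c) = (lborel :: complex measure)"
proof (rule measure_eqI)
  fix A assume "A \<in> sets (distr lborel borel ((*) c :: complex \<Rightarrow> complex))"
  then have [measurable]: "A \<in> sets borel" by simp
  have "emeasure (distr lborel borel ((*) c)) A = (\<integral>\<^sup>+z. indicator A (c * z) \<partial>lborel)"
    by (subst nn_integral_indicator[symmetric], simp, subst nn_integral_distr) auto
  also have "\<dots> = emeasure lborel A"
    using nn_integral_lborel_rotation[OF _ assms, of "indicator A"] by simp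
  finally show "emeasure (distr lborel borel ((*) c)) A = emeasure lborel A" .
qed simp

lemma integral_lborel_rotation:
  fixes f :: "complex \<Rightarrow> 'a::{banach, second_countable_topology}"
  assumes "f \<in> borel_measurable borel" "norm c = 1"
  shows "(\<integral>z. f (c * z) \<partial>lborel) = (\<integral>z. f z \<partial>lborel)"
  using integral_distr[of "(*) c" lborel borel f] assms by (simp add: lborel_distr_rotation)

text \<open>A rotation by the angle \<open>t\<close> with \<open>(a - b) * t = pi\<close> leaves the
  radial weight alone and multiplies the monomial by -1, so the integral equals its own negative.
  This is the source of every orthogonality relation below.\<close>

lemma integral_lborel_radial_monomial:
  fixes w :: "real \<Rightarrow> real"
  assumes [measurable]: "w \<in> borel_measurable borel" and "a \<noteq> b"
  shows "(\<integral>z. w (norm z) *\<^sub>R (z ^ a * cnj z ^ b) \<partial>lborel) = 0"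
proof -
  define t where "t = pi / (real a - real b)"
  define c where "c = cis t"
  let ?f = "\<lambda>z. w (norm z) *\<^sub>R (z ^ a * cnj z ^ b)"
  have "c ^ a * cnj c ^ b = cis (real a * t) * cis (- (real b * t))"
    by (simp add: c_def cis_cnj Complex.DeMoivre)
  also have "\<dots> = cis ((real a - real b) * t)"
    by (simp add: cis_mult left_diff_distrib)
  also have "(real a - real b) * t = pi"
    using assms(2) by (simp add: t_def)
  finally have c: "c ^ a * cnj c ^ b = -1" by simp
  have "?f (c * z) = (c ^ a * cnj c ^ b) * ?f z" for z
    by (simp add: norm_mult c_def power_mult_distrib scaleR_conv_of_real mult_ac)
  then have "?f (c * z) = - ?f z" for z by (simp add: c)
  moreover have "(\<integral>z. ?f (c * z) \<partial>lborel) = (\<integral>z. ?f z \<partial>lborel)"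
  proof (rule integral_lborel_rotation)
    show "?f \<in> borel_measurable borel" by measurable
  qed (simp add: c_def)
  ultimately show ?thesis by simp
qed

section \<open>The weighted measure\<close>

text \<open>The indicator is needed since \<open>powr\<close> of a negative base is junk.\<close>

definition disc_weight :: "real \<Rightarrow> real \<Rightarrow> real" where
  "disc_weight \<gamma> x = indicator {..<1} x * (1 - x\<^sup>2) powr \<gamma>"

lemma borel_measurable_disc_weight [measurable]: "disc_weight \<gamma> \<in> borel_measurable borel"
  unfolding disc_weight_def[abs_def] by measurable

lemma space_disc_measure: "space (\<mu> \<gamma>) = \<D>"
  by (simp add: disc_measure_def)

lemma sets_disc_measure: "sets (\<mu> \<gamma>) = sets (lebesgue_on \<D>)"
  by (simp add: disc_measure_def)

lemma borel_measurable_disc_measure: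
  assumes "f \<in> borel_measurable borel"
  shows "f \<in> borel_measurable (\<mu> \<gamma>)"
proof -
  have "f \<in> borel_measurable (lebesgue_on \<D>)"
    using assms by (intro measurable_restrict_space1 measurable_completion) simp
  then show ?thesis
    by (subst measurable_cong_sets[OF sets_disc_measure refl])
qed

lemma borel_measurable_disc_measure_iff:
  "f \<in> borel_measurable (\<mu> \<gamma>) \<longleftrightarrow> f \<in> borel_measurable (lebesgue_on \<D>)"
  by (rule measurable_cong_sets[OF sets_disc_measure refl, THEN arg_cong])

lemma borel_measurable_disc_density:
  "(\<lambda>z. (1 - (norm z)\<^sup>2) powr \<gamma>) \<in> borel_measurable (lebesgue_on (\<D> :: complex set))"
  by (intro measurable_restrict_space1 measurable_completion) measurable

text \<open>Moves integrals to \<open>lborel\<close>, where the rotation argument lives; Borel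
  measurability of \<open>f\<close> permits leaving the completed measure.\<close>

lemma integral_disc_measure:
  fixes f :: "complex \<Rightarrow> 'a::{banach, second_countable_topology}"
  assumes [measurable]: "f \<in> borel_measurable borel"
  shows "(\<integral>z. f z \<partial>\<mu> \<gamma>) = (\<integral>z. disc_weight \<gamma> (norm z) *\<^sub>R f z \<partial>lborel)"
proof -
  have "f \<in> borel_measurable (lebesgue_on \<D>)"
    using borel_measurable_disc_measure[OF assms] by (simp add: borel_measurable_disc_measure_iff)
  then have "(\<integral>z. f z \<partial>\<mu> \<gamma>) = (\<integral>z. (1 - (norm z)\<^sup>2) powr \<gamma> *\<^sub>R f z \<partial>lebesgue_on \<D>)"
    unfolding disc_measure_def by (intro integral_density borel_measurable_disc_density) auto
  also have "\<dots> = (\<integral>z. indicator \<D> z *\<^sub>R (1 - (norm z)\<^sup>2) powr \<gamma> *\<^sub>R f z \<partial>lebesgue)"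
    by (intro integral_restrict_space) simp
  also have "\<dots> = (\<integral>z. disc_weight \<gamma> (norm z) *\<^sub>R f z \<partial>lebesgue)"
    by (intro Bochner_Integration.integral_cong refl) (simp add: disc_weight_def indicator_def)
  also have "\<dots> = (\<integral>z. disc_weight \<gamma> (norm z) *\<^sub>R f z \<partial>lborel)"
    by (intro integral_completion) measurable
  finally show ?thesis .
qed

text \<open>For \<open>\<gamma> < 0\<close> the weight is at most \<open>2 powr (- \<gamma> * (k + 1))\<close> where \<open>1 - |z|\<^sup>2\<close> lies in
  \<open>(1 / 2 ^ (k + 1), 1 / 2 ^ k]\<close>, an annulus of area at most \<open>pi / 2 ^ k\<close>; the resulting geometric series
  converges for \<open>\<gamma> > -1\<close>.\<close>

lemma nn_integral_disc_weight_finite: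
  assumes "\<gamma> > -1"
  shows "(\<integral>\<^sup>+z. ennreal (disc_weight \<gamma> (norm z)) \<partial>(lborel :: complex measure)) < \<infinity>"
proof (cases "\<gamma> \<ge> 0")
  case True
  have "(\<integral>\<^sup>+z. ennreal (disc_weight \<gamma> (norm z)) \<partial>(lborel :: complex measure))
      \<le> (\<integral>\<^sup>+z. indicator \<D> z \<partial>lborel)"
  proof (intro nn_integral_mono)
    fix z :: complex
    have "(1 - (norm z)\<^sup>2) powr \<gamma> \<le> 1" if "norm z < 1"
      using that True by (intro powr_le1) (auto simp: power_le_one)
    then show "ennreal (disc_weight \<gamma> (norm z)) \<le> indicator \<D> z"
      by (auto simp: disc_weight_def indicator_def)
  qed
  also have "\<dots> < \<infinity>" by (simp add: emeasure_ball unit_ball_vol_2)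
  finally show ?thesis .
next
  case False
  define q :: real where "q = (1 / 2) powr \<gamma>"
  have q: "((1 / 2) ^ m) powr \<gamma> = q ^ m" for m
    by (simp add: q_def powr_power powr_powr mult.commute flip: powr_realpow)
  have q0: "q > 0" by (simp add: q_def)
  have q1: "q / 2 < 1"
  proof -
    have "q / 2 = (1 / 2) powr (\<gamma> + 1)" by (simp add: q_def powr_add)
    also have "\<dots> < (1 / 2) powr 0" using assms by (intro powr_less_mono') auto
    finally show ?thesis by simp
  qed
  define A where "A = (\<lambda>k::nat. (\<D> :: complex set) - ball 0 (sqrt (1 - (1 / 2) ^ k)))"
  have A: "emeasure lborel (A k) = ennreal (pi * (1 / 2) ^ k)" for k
  proof -
    have p: "(1 / 2 :: real) ^ k \<le> 1" by (simp add: power_le_one)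
    have "emeasure lborel (A k)
        = emeasure lborel (\<D> :: complex set) - emeasure lborel (ball (0::complex) (sqrt (1 - (1 / 2) ^ k)))"
      unfolding A_def by (intro emeasure_Diff subset_ball) (simp_all add: p emeasure_ball)
    also have "\<dots> = ennreal (pi - pi * (1 - (1 / 2) ^ k))"
      using p by (simp add: emeasure_ball unit_ball_vol_2 ennreal_minus)
    finally show ?thesis by (simp add: algebra_simps)
  qed
  have [measurable]: "A k \<in> sets lborel" for k by (simp add: A_def)
  have term_le_suminf: "f k \<le> suminf f" for f :: "nat \<Rightarrow> ennreal" and k
    using sum_le_suminf[of f "{k}"] by simp
  have "(\<integral>\<^sup>+z. ennreal (disc_weight \<gamma> (norm z)) \<partial>(lborel :: complex measure))
      \<le> (\<integral>\<^sup>+z. (\<Sum>k. ennreal (q ^ Suc k) * indicator (A k) z) \<partial>lborel)"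
  proof (intro nn_integral_mono)
    fix z :: complex
    show "ennreal (disc_weight \<gamma> (norm z)) \<le> (\<Sum>k. ennreal (q ^ Suc k) * indicator (A k) z)"
    proof (cases "norm z < 1")
      case True
      define s where "s = 1 - (norm z)\<^sup>2"
      have s: "0 < s" "s \<le> 1"
        using True by (auto simp: s_def power2_eq_square abs_square_less_1 simp flip: power2_eq_square)
      define k where "k = (LEAST k. (1 / 2) ^ Suc k < s)"
      obtain m where "(1 / 2) ^ m < s" using real_arch_pow_inv[OF s(1), of "1 / 2"] by auto
      then have "(1 / 2) ^ Suc m < s"
        using le_less_trans[OF power_decreasing[of m "Suc m" "1 / 2 :: real"]] by simp
      then have k: "(1 / 2) ^ Suc k < s" unfolding k_def by (rule LeastI)
      have k': "s \<le> (1 / 2) ^ k"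
      proof (cases k)
        case (Suc l)
        then have "\<not> (1 / 2) ^ Suc l < s" using not_less_Least[of l "\<lambda>k. (1 / 2) ^ Suc k < s"]
          by (simp add: k_def)
        with Suc show ?thesis by simp
      qed (use s in simp)
      have "disc_weight \<gamma> (norm z) = s powr \<gamma>" using True by (simp add: disc_weight_def s_def)
      also have "\<dots> \<le> ((1 / 2) ^ Suc k) powr \<gamma>"
        using k False by (intro powr_mono2') auto
      also have "\<dots> = q ^ Suc k" by (rule q)
      finally have 1: "disc_weight \<gamma> (norm z) \<le> q ^ Suc k" .
      have "sqrt (1 - (1 / 2) ^ k) \<le> norm z"
        using k' by (intro real_le_lsqrt) (auto simp: s_def power_le_one)
      then have "z \<in> A k" using True by (auto simp: A_def)
      then have "ennreal (disc_weight \<gamma> (norm z)) \<le> ennreal (q ^ Suc k) * indicator (A k) z"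
        using 1 by (simp add: ennreal_leI)
      also have "\<dots> \<le> (\<Sum>k. ennreal (q ^ Suc k) * indicator (A k) z)"
        by (rule term_le_suminf)
      finally show ?thesis .
    qed (simp add: disc_weight_def)
  qed
  also have "\<dots> = (\<Sum>k. \<integral>\<^sup>+z. ennreal (q ^ Suc k) * indicator (A k) z \<partial>lborel)"
    by (intro nn_integral_suminf) measurable
  also have "\<dots> = (\<Sum>k. ennreal (q * pi * (q / 2) ^ k))"
  proof (intro suminf_cong)
    fix k
    have "(\<integral>\<^sup>+z. ennreal (q ^ Suc k) * indicator (A k) z \<partial>lborel) = ennreal (q ^ Suc k) * ennreal (pi * (1 / 2) ^ k)"
      by (subst nn_integral_cmult_indicator) (simp_all only: A, measurable)
    also have "\<dots> = ennreal (q ^ Suc k * (pi * (1 / 2) ^ k))"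
      using q0 by (intro ennreal_mult[symmetric]) auto
    also have "q ^ Suc k * (pi * (1 / 2) ^ k) = q * pi * (q / 2) ^ k"
      by (simp add: power_divide)
    finally show "(\<integral>\<^sup>+z. ennreal (q ^ Suc k) * indicator (A k) z \<partial>lborel) = ennreal (q * pi * (q / 2) ^ k)" .
  qed
  also have "\<dots> = ennreal (\<Sum>k. q * pi * (q / 2) ^ k)"
    using q0 q1 by (intro suminf_ennreal2 summable_mult summable_geometric) auto
  also have "\<dots> < \<infinity>" by simp
  finally show ?thesis .
qed

text \<open>Finite total mass puts every polynomial in \<open>z\<close> and \<open>cnj z\<close>
  into \<open>L2 \<gamma>\<close> and makes square integrable functions integrable.\<close>

lemma finite_disc_measure:
  assumes "\<gamma> > -1"
  shows "finite_measure (\<mu> \<gamma>)"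
proof
  have "emeasure (\<mu> \<gamma>) (space (\<mu> \<gamma>)) = (\<integral>\<^sup>+z. ennreal ((1 - (norm z)\<^sup>2) powr \<gamma>) \<partial>lebesgue_on \<D>)"
    unfolding disc_measure_def
    by (subst emeasure_density)
      (auto intro!: nn_integral_cong borel_measurable_disc_density[THEN measurable_compose] simp: indicator_def)
  also have "\<dots> = (\<integral>\<^sup>+z. ennreal ((1 - (norm z)\<^sup>2) powr \<gamma>) * indicator \<D> z \<partial>lebesgue)"
    by (intro nn_integral_restrict_space) simp
  also have "\<dots> = (\<integral>\<^sup>+z. ennreal (disc_weight \<gamma> (norm z)) \<partial>(lebesgue :: complex measure))"
    by (intro nn_integral_cong) (simp add: disc_weight_def indicator_def)
  also have "\<dots> = (\<integral>\<^sup>+z. ennreal (disc_weight \<gamma> (norm z)) \<partial>(lborel :: complex measure))"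
    by (intro nn_integral_completion) measurable
  finally show "emeasure (\<mu> \<gamma>) (space (\<mu> \<gamma>)) \<noteq> \<infinity>"
    using nn_integral_disc_weight_finite[OF assms] by simp
qed

section \<open>Bounded functions, limits, and the embedding of L2 into L1\<close>

lemma integrable_disc_measure_bounded:
  fixes f :: "complex \<Rightarrow> 'a::{banach, second_countable_topology}"
  assumes "\<gamma> > -1" "f \<in> borel_measurable borel" "\<And>z. norm z < 1 \<Longrightarrow> norm (f z) \<le> B"
  shows "integrable (\<mu> \<gamma>) f"
proof -
  interpret finite_measure "\<mu> \<gamma>" by (rule finite_disc_measure[OF assms(1)])
  have "AE z in \<mu> \<gamma>. norm (f z) \<le> B"
    using assms(3) by (intro AE_I2) (simp add: space_disc_measure)
  then show ?thesis
    using borel_measurable_disc_measure[OF assms(2)] by (rule integrable_const_bound)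
qed

text \<open>The bound is asked for only eventually, which fits both uses: differences
  \<open>S M - S N\<close> with \<open>M \<ge> N\<close>, and errors that eventually fall below a
  given epsilon.\<close>

lemma L2_norm_Fatou:
  assumes u: "\<And>i. u i \<in> L2 \<gamma>" and f: "f \<in> borel_measurable (\<mu> \<gamma>)"
    and lim: "AE z in \<mu> \<gamma>. (\<lambda>i. u i z) \<longlonglongrightarrow> f z"
    and le: "eventually (\<lambda>i. L2_norm \<gamma> (u i) \<le> c) sequentially"
  shows "f \<in> L2 \<gamma>" "L2_norm \<gamma> f \<le> c"
proof -
  have [measurable]: "f \<in> borel_measurable (\<mu> \<gamma>)" "u i \<in> borel_measurable (\<mu> \<gamma>)" for i
    using u f by (auto simp: L2_def)
  obtain i where "L2_norm \<gamma> (u i) \<le> c" using le by (auto simp: eventually_sequentially)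
  then have c: "c \<ge> 0" using L2_norm_nonneg[of \<gamma> "u i"] by linarith
  have "(\<integral>\<^sup>+z. ennreal ((norm (f z))\<^sup>2) \<partial>\<mu> \<gamma>)
      = (\<integral>\<^sup>+z. liminf (\<lambda>i. ennreal ((norm (u i z))\<^sup>2)) \<partial>\<mu> \<gamma>)"
  proof (rule nn_integral_cong_AE)
    show "AE z in \<mu> \<gamma>. ennreal ((norm (f z))\<^sup>2) = liminf (\<lambda>i. ennreal ((norm (u i z))\<^sup>2))"
      using lim
    proof eventually_elim
      case (elim z)
      then have "(\<lambda>i. ennreal ((norm (u i z))\<^sup>2)) \<longlonglongrightarrow> ennreal ((norm (f z))\<^sup>2)"
        by (intro tendsto_ennrealI tendsto_intros)
      then show ?case using lim_imp_Liminf[OF sequentially_bot] by fastforce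
    qed
  qed
  also have "\<dots> \<le> liminf (\<lambda>i. \<integral>\<^sup>+z. ennreal ((norm (u i z))\<^sup>2) \<partial>\<mu> \<gamma>)"
    by (rule nn_integral_liminf) measurable
  also have "\<dots> \<le> ennreal (c\<^sup>2)"
  proof -
    have "eventually (\<lambda>i. (\<integral>\<^sup>+z. ennreal ((norm (u i z))\<^sup>2) \<partial>\<mu> \<gamma>) \<le> ennreal (c\<^sup>2)) sequentially"
      using le
    proof eventually_elim
      case (elim i)
      have "(\<integral>\<^sup>+z. ennreal ((norm (u i z))\<^sup>2) \<partial>\<mu> \<gamma>) = ennreal ((L2_norm \<gamma> (u i))\<^sup>2)"
        using u[of i] unfolding L2_norm_power2 by (intro nn_integral_eq_integral) (auto simp: L2_def)
      then show ?case using elim c L2_norm_nonneg[of \<gamma> "u i"] by (simp add: ennreal_leI power_mono)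
    qed
    then have "limsup (\<lambda>i. \<integral>\<^sup>+z. ennreal ((norm (u i z))\<^sup>2) \<partial>\<mu> \<gamma>) \<le> ennreal (c\<^sup>2)"
      by (rule Limsup_bounded)
    then show ?thesis using Liminf_le_Limsup[OF sequentially_bot] order_trans by blast
  qed
  finally have le: "(\<integral>\<^sup>+z. ennreal ((norm (f z))\<^sup>2) \<partial>\<mu> \<gamma>) \<le> ennreal (c\<^sup>2)" .
  have int: "integrable (\<mu> \<gamma>) (\<lambda>z. (norm (f z))\<^sup>2)"
    using le by (intro integrableI_bounded) (auto simp: le_less_trans)
  then show "f \<in> L2 \<gamma>" by (simp add: L2_def)
  have "ennreal ((L2_norm \<gamma> f)\<^sup>2) = (\<integral>\<^sup>+z. ennreal ((norm (f z))\<^sup>2) \<partial>\<mu> \<gamma>)"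
    unfolding L2_norm_power2 by (intro nn_integral_eq_integral[symmetric] int) auto
  from this le have "ennreal ((L2_norm \<gamma> f)\<^sup>2) \<le> ennreal (c\<^sup>2)" by (rule ord_eq_le_trans)
  then have "(L2_norm \<gamma> f)\<^sup>2 \<le> c\<^sup>2" by (rule ennreal_le_iff[THEN iffD1, rotated]) simp
  then show "L2_norm \<gamma> f \<le> c" by (rule power2_le_imp_le) (rule c)
qed

lemma L2_norm_eq_0_AE:
  assumes "f \<in> L2 \<gamma>" "L2_norm \<gamma> f = 0"
  shows "AE z in \<mu> \<gamma>. f z = 0"
proof -
  have "(\<integral>z. (norm (f z))\<^sup>2 \<partial>\<mu> \<gamma>) = 0"
    using assms(2) L2_norm_power2[of \<gamma> f] by simp
  then have "AE z in \<mu> \<gamma>. (norm (f z))\<^sup>2 = 0"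
    using assms(1) by (subst (asm) integral_nonneg_eq_0_iff_AE) (auto simp: L2_def)
  then show ?thesis by simp
qed

lemma L2_cong_AE:
  assumes f: "f \<in> L2 \<gamma>" and g: "g \<in> borel_measurable (\<mu> \<gamma>)" and eq: "AE z in \<mu> \<gamma>. f z = g z"
  shows "g \<in> L2 \<gamma>" "L2_norm \<gamma> g = L2_norm \<gamma> f"
proof -
  have [measurable]: "f \<in> borel_measurable (\<mu> \<gamma>)" "g \<in> borel_measurable (\<mu> \<gamma>)"
    using f g by (auto simp: L2_def)
  have eq': "AE z in \<mu> \<gamma>. (norm (f z))\<^sup>2 = (norm (g z))\<^sup>2" using eq by eventually_elim simp
  have "integrable (\<mu> \<gamma>) (\<lambda>z. (norm (f z))\<^sup>2) \<longleftrightarrow> integrable (\<mu> \<gamma>) (\<lambda>z. (norm (g z))\<^sup>2)"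
    by (rule integrable_cong_AE[OF _ _ eq']) measurable
  with f show "g \<in> L2 \<gamma>" by (simp add: L2_def)
  have "(\<integral>z. (norm (f z))\<^sup>2 \<partial>\<mu> \<gamma>) = (\<integral>z. (norm (g z))\<^sup>2 \<partial>\<mu> \<gamma>)"
    by (rule integral_cong_AE[OF _ _ eq']) measurable
  then show "L2_norm \<gamma> g = L2_norm \<gamma> f" by (simp add: L2_norm_eq)
qed

text \<open>Young's inequality \<open>2 * norm (f z) \<le> s + (norm (f z))\<^sup>2 / s\<close> is
  integrated for \<open>s\<close> just above the norm of \<open>f\<close>. In the constant, the
  measure comes from integrating \<open>s\<close> and the 1 from the quadratic term.\<close>

lemma L2_integrable_norm:
  assumes "\<gamma> > -1" and f: "f \<in> L2 \<gamma>"
  shows "integrable (\<mu> \<gamma>) (\<lambda>z. norm (f z))"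
    and "(\<integral>z. norm (f z) \<partial>\<mu> \<gamma>) \<le> (measure (\<mu> \<gamma>) \<D> + 1) / 2 * L2_norm \<gamma> f"
proof -
  interpret finite_measure "\<mu> \<gamma>" by (rule finite_disc_measure[OF assms(1)])
  have [measurable]: "f \<in> borel_measurable (\<mu> \<gamma>)" using f by (auto simp: L2_def)
  have int2: "integrable (\<mu> \<gamma>) (\<lambda>z. (norm (f z))\<^sup>2)" using f by (auto simp: L2_def)
  have young: "norm (f z) \<le> (s + (norm (f z))\<^sup>2 / s) / 2" if "s > 0" for s z
  proof -
    have "0 \<le> (s - norm (f z))\<^sup>2 / s" using that by simp
    also have "\<dots> = s + (norm (f z))\<^sup>2 / s - 2 * norm (f z)"
      using that by (simp add: power2_eq_square field_simps)
    finally show ?thesis by simp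
  qed
  show int: "integrable (\<mu> \<gamma>) (\<lambda>z. norm (f z))"
  proof (rule Bochner_Integration.integrable_bound)
    show "integrable (\<mu> \<gamma>) (\<lambda>z. (1 + (norm (f z))\<^sup>2 / 1) / 2)" using int2 by simp
    show "AE z in \<mu> \<gamma>. norm (norm (f z)) \<le> norm ((1 + (norm (f z))\<^sup>2 / 1) / 2)"
      using young[of 1] by simp
  qed measurable
  define K where "K = (measure (\<mu> \<gamma>) \<D> + 1) / 2"
  have K: "K > 0" by (simp add: K_def add_nonneg_pos)
  \<comment> \<open>The strict inequality keeps \<open>s\<close> positive even if the norm is 0;
    afterwards \<open>s\<close> decreases to the norm.\<close>
  have "(\<integral>z. norm (f z) \<partial>\<mu> \<gamma>) / K \<le> s" if "s > L2_norm \<gamma> f" for s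
  proof -
    have s: "s > 0" using that L2_norm_nonneg[of \<gamma> f] by linarith
    have "(\<integral>z. norm (f z) \<partial>\<mu> \<gamma>) \<le> (\<integral>z. (s + (norm (f z))\<^sup>2 / s) / 2 \<partial>\<mu> \<gamma>)"
      using int int2 young[OF s] by (intro integral_mono) auto
    also have "\<dots> = (measure (\<mu> \<gamma>) \<D> * s + (L2_norm \<gamma> f)\<^sup>2 / s) / 2"
      using int2 by (simp add: L2_norm_power2 space_disc_measure)
    also have "(L2_norm \<gamma> f)\<^sup>2 / s \<le> s\<^sup>2 / s"
      using that s L2_norm_nonneg[of \<gamma> f] by (intro divide_right_mono power_mono) auto
    also have "(measure (\<mu> \<gamma>) \<D> * s + s\<^sup>2 / s) / 2 = s * K"
      using s by (simp add: K_def power2_eq_square algebra_simps)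
    finally show ?thesis using K by (simp add: pos_divide_le_eq)
  qed
  then have "(\<integral>z. norm (f z) \<partial>\<mu> \<gamma>) / K \<le> L2_norm \<gamma> f" by (rule dense_ge)
  then show "(\<integral>z. norm (f z) \<partial>\<mu> \<gamma>) \<le> (measure (\<mu> \<gamma>) \<D> + 1) / 2 * L2_norm \<gamma> f"
    using K by (simp add: pos_divide_le_eq mult.commute flip: K_def)
qed

lemma borel_measurable_disc_measure_continuous:
  "continuous_on \<D> f \<Longrightarrow> f \<in> borel_measurable (\<mu> \<gamma>)"
  by (simp add: borel_measurable_disc_measure_iff continuous_imp_measurable_on_sets_lebesgue)

section \<open>Coefficient bounds\<close>

lemma of_real_norm_power_double: "complex_of_real (norm z ^ (2 * n)) = z ^ n * cnj z ^ n"
proof -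
  have "complex_of_real (norm z ^ (2 * n)) = complex_of_real ((norm z)\<^sup>2) ^ n"
    by (simp add: power_mult)
  then show ?thesis unfolding complex_norm_square by (simp add: power_mult_distrib)
qed

lemma holomorphic_ball_taylor:
  assumes "\<phi> holomorphic_on ball 0 R"
  obtains a where "\<And>z. norm z < R \<Longrightarrow> (\<lambda>m. a m * z ^ m) sums \<phi> z"
    and "\<And>r. 0 \<le> r \<Longrightarrow> r < R \<Longrightarrow> summable (\<lambda>m. norm (a m) * r ^ m)"
proof
  define a where "a = (\<lambda>m. (deriv ^^ m) \<phi> 0 / fact m)"
  show sums: "(\<lambda>m. a m * z ^ m) sums \<phi> z" if "norm z < R" for z
    using holomorphic_power_series[OF assms, of z] that by (simp add: a_def)
  show "summable (\<lambda>m. norm (a m) * r ^ m)" if "0 \<le> r" "r < R" for r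
  proof -
    \<comment> \<open>At the midpoint of \<open>r\<close> and \<open>R\<close> the series still
      converges, which yields absolute convergence at the smaller radius \<open>r\<close>.\<close>
    have "summable (\<lambda>m. a m * of_real ((r + R) / 2) ^ m)"
      using that by (intro sums_summable[OF sums]) (simp only: norm_of_real, simp)
    then have "summable (\<lambda>m. norm (a m * of_real r ^ m))"
      by (rule powser_insidea) (use that in \<open>simp only: norm_of_real, simp\<close>)
    then show ?thesis using that by (simp add: norm_mult norm_power)
  qed
qed

section \<open>Moments over discs\<close>

lemma integral_cball_monomial:
  assumes "a \<noteq> b"
  shows "(\<integral>z. indicator (cball 0 r) z *\<^sub>R (z ^ a * cnj z ^ b) \<partial>lborel) = 0"
proof -
  have "(\<integral>z. indicator (cball 0 r) z *\<^sub>R (z ^ a * cnj z ^ b) \<partial>lborel)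
      = (\<integral>z. indicator {..r} (norm z) *\<^sub>R (z ^ a * cnj z ^ b) \<partial>lborel)"
    by (intro Bochner_Integration.integral_cong refl) (simp add: indicator_def)
  also have "\<dots> = 0"
    by (rule integral_lborel_radial_monomial) (use assms in auto)
  finally show ?thesis .
qed

text \<open>The Taylor series of \<open>\<phi>\<close> produces monomials of angular mode
  \<open>n + m - k\<close>. As \<open>k \<le> n\<close>, mode 0 occurs only for \<open>m = 0\<close>
  and \<open>k = n\<close>, and the coefficient there is \<open>\<phi> 0\<close>.\<close>

lemma integral_cball_cnj_power_mult_holomorphic:
  assumes hol: "\<phi> holomorphic_on ball 0 R" and r: "0 \<le> r" "r < R" and kn: "k \<le> n"
  shows "(\<integral>u. indicator (cball 0 r) u *\<^sub>R (cnj u ^ k * u ^ n * \<phi> u) \<partial>lborel) =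
    (if k = n then \<phi> 0 * of_real (\<integral>u. indicator (cball (0::complex) r) u * norm u ^ (2 * n) \<partial>lborel) else 0)"
proof -
  obtain a where a: "\<And>z. norm z < R \<Longrightarrow> (\<lambda>m. a m * z ^ m) sums \<phi> z"
    and sm: "summable (\<lambda>m. norm (a m) * r ^ m)"
    using holomorphic_ball_taylor[OF hol] r by metis
  define C where "C = (\<Sum>m. norm (a m) * r ^ m)"
  define s where "s = (\<lambda>i u. indicator (cball 0 r) u *\<^sub>R (cnj u ^ k * u ^ n * (\<Sum>m<i. a m * u ^ m)))"
  define M where "M = (\<lambda>m. \<integral>u. indicator (cball 0 r) u *\<^sub>R (u ^ (n + m) * cnj u ^ k) \<partial>lborel)"
  have lim: "(\<lambda>i. s i u) \<longlonglongrightarrow> indicator (cball 0 r) u *\<^sub>R (cnj u ^ k * u ^ n * \<phi> u)" for u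
  proof (cases "norm u \<le> r")
    case True
    then have "(\<lambda>m. a m * u ^ m) sums \<phi> u" using a r by simp
    then show ?thesis unfolding s_def sums_def by (intro tendsto_intros)
  qed (simp add: s_def)
  have bound: "norm (s i u) \<le> indicator (cball 0 r) u * (r ^ k * r ^ n * C)" for i u
  proof (cases "norm u \<le> r")
    case True
    have "norm (\<Sum>m<i. a m * u ^ m) \<le> (\<Sum>m<i. norm (a m) * r ^ m)"
      using True by (intro sum_norm_le) (simp add: norm_mult norm_power mult_left_mono power_mono)
    also have "\<dots> \<le> C" unfolding C_def using sm r by (intro sum_le_suminf) auto
    finally have "norm (cnj u ^ k * u ^ n * (\<Sum>m<i. a m * u ^ m)) \<le> r ^ k * r ^ n * C"
      unfolding norm_mult norm_power complex_mod_cnj using True r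
      by (intro mult_mono power_mono) auto
    then show ?thesis using True by (simp add: s_def)
  qed (simp add: s_def)
  have "(\<lambda>i. \<integral>u. s i u \<partial>lborel) \<longlonglongrightarrow> (\<integral>u. indicator (cball 0 r) u *\<^sub>R (cnj u ^ k * u ^ n * \<phi> u) \<partial>lborel)"
  proof (rule integral_dominated_convergence)
    show s_meas: "s i \<in> borel_measurable lborel" for i
      unfolding s_def by (intro borel_measurable_integrable borel_integrable_compact continuous_intros) simp
    show "(\<lambda>u. indicator (cball 0 r) u *\<^sub>R (cnj u ^ k * u ^ n * \<phi> u)) \<in> borel_measurable lborel"
      by (rule borel_measurable_LIMSEQ_metric[OF s_meas lim])
    show "integrable lborel (\<lambda>u. indicator (cball (0::complex) r) u * (r ^ k * r ^ n * C))"
      using borel_integrable_compact[of "cball (0::complex) r" "\<lambda>_. r ^ k * r ^ n * C"] by simp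
  qed (use lim bound in auto)
  moreover have "(\<integral>u. s i u \<partial>lborel) = (\<Sum>m<i. a m * M m)" for i
  proof -
    define g where "g = (\<lambda>m u. indicator (cball 0 r) u *\<^sub>R (u ^ (n + m) * cnj u ^ k))"
    have "s i = (\<lambda>u. \<Sum>m<i. a m * g m u)"
      by (rule ext) (simp add: s_def g_def sum_distrib_left scaleR_sum_right power_add mult_ac)
    moreover have "integrable lborel (g m)" for m
      unfolding g_def by (intro borel_integrable_compact continuous_intros) auto
    moreover have "M m = (\<integral>u. g m u \<partial>lborel)" for m
      unfolding M_def g_def ..
    ultimately show ?thesis by simp
  qed
  moreover have "M m = 0" if "n + m \<noteq> k" for m
    unfolding M_def using that by (rule integral_cball_monomial)
  \<comment> \<open>Only sums with at least one term are evaluated, since the whole value sits in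
    the term \<open>m = 0\<close>.\<close>
  then have "(\<Sum>m<Suc i. a m * M m) = (if k = n then a 0 * M 0 else 0)" for i
    using kn unfolding sum.lessThan_Suc_shift by (auto intro!: sum.neutral)
  then have "(\<lambda>i. \<Sum>m<i. a m * M m) \<longlonglongrightarrow> (if k = n then a 0 * M 0 else 0)"
    by (subst filterlim_sequentially_Suc[symmetric]) simp
  ultimately have *: "(\<integral>u. indicator (cball 0 r) u *\<^sub>R (cnj u ^ k * u ^ n * \<phi> u) \<partial>lborel)
      = (if k = n then a 0 * M 0 else 0)"
    using LIMSEQ_unique by fastforce
  have "(\<lambda>m. a m * 0 ^ m) sums \<phi> 0"
    by (rule a) (use r in simp)
  then have "a 0 = \<phi> 0"
    by (rule sums_unique2[OF powser_sums_zero])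
  moreover have "M 0 = of_real (\<integral>u. indicator (cball (0::complex) r) u * norm u ^ (2 * n) \<partial>lborel)" if "k = n"
  proof -
    have "indicator (cball 0 r) u *\<^sub>R (u ^ (n + 0) * cnj u ^ k)
        = complex_of_real (indicator (cball (0::complex) r) u * norm u ^ (2 * n))" for u
      using that by (simp add: scaleR_conv_of_real of_real_norm_power_double del: of_real_power)
    then show ?thesis unfolding M_def by (simp only: integral_complex_of_real)
  qed
  ultimately show ?thesis using * by simp
qed

lemma integral_lborel_translate:
  fixes f :: "'a::euclidean_space \<Rightarrow> 'b::{banach, second_countable_topology}"
  assumes "f \<in> borel_measurable borel"
  shows "(\<integral>x. f (a + x) \<partial>lborel) = (\<integral>x. f x \<partial>lborel)"
  using integral_distr[of "(+) a" lborel borel f] assms by (simp add: lborel_distr_plus)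

lemma integral_cball_leading_coeff:
  assumes hol: "\<And>j. j \<le> n \<Longrightarrow> \<phi> j holomorphic_on ball z0 R" and r: "0 \<le> r" "r < R"
  shows "(\<integral>u. indicator (cball 0 r) u *\<^sub>R (u ^ n * (\<Sum>j\<le>n. cnj (z0 + u) ^ j * \<phi> j (z0 + u))) \<partial>lborel) =
    \<phi> n z0 * of_real (\<integral>u. indicator (cball (0::complex) r) u * norm u ^ (2 * n) \<partial>lborel)"
proof -
  define I where "I = (\<lambda>j k u. indicator (cball 0 r) u *\<^sub>R (cnj u ^ k * u ^ n * \<phi> j (z0 + u)))"
  define c where "c = (\<lambda>j k. of_nat (j choose k) * cnj z0 ^ (j - k))"
  have hol': "(\<lambda>u. \<phi> j (z0 + u)) holomorphic_on ball 0 R" if "j \<le> n" for j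
  proof -
    have "\<phi> j \<circ> (\<lambda>u. z0 + u) holomorphic_on ball 0 R"
      using hol[OF that] by (intro holomorphic_on_compose holomorphic_intros) simp
    then show ?thesis by (simp add: o_def)
  qed
  have int: "integrable lborel (I j k)" if "j \<le> n" for j k
    unfolding I_def
  proof (rule borel_integrable_compact)
    have "continuous_on (cball 0 r) (\<lambda>u. \<phi> j (z0 + u))"
      by (rule continuous_on_subset[OF holomorphic_on_imp_continuous_on[OF hol'[OF that]]])
        (use r in auto)
    then show "continuous_on (cball 0 r) (\<lambda>u. cnj u ^ k * u ^ n * \<phi> j (z0 + u))"
      by (intro continuous_intros)
  qed simp
  have eq: "indicator (cball 0 r) u *\<^sub>R (u ^ n * (\<Sum>j\<le>n. cnj (z0 + u) ^ j * \<phi> j (z0 + u)))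
      = (\<Sum>j\<le>n. \<Sum>k\<le>j. c j k * I j k u)" for u
  proof -
    have "cnj (z0 + u) ^ j = (\<Sum>k\<le>j. of_nat (j choose k) * cnj u ^ k * cnj z0 ^ (j - k))" for j
      using binomial_ring[of "cnj u" "cnj z0" j] by (simp add: add.commute)
    then show ?thesis
      by (simp add: I_def c_def sum_distrib_left sum_distrib_right scaleR_sum_right mult_ac)
  qed
  have "(\<integral>u. (\<Sum>j\<le>n. \<Sum>k\<le>j. c j k * I j k u) \<partial>lborel) = (\<Sum>j\<le>n. \<Sum>k\<le>j. c j k * (\<integral>u. I j k u \<partial>lborel))"
    using int by simp
  \<comment> \<open>The binomial index satisfies \<open>k \<le> j \<le> n\<close>, so the surviving
    case \<open>k = n\<close> forces \<open>j = n\<close>, where \<open>c n n = 1\<close>.\<close>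
  also have "\<dots> = (\<Sum>j\<le>n. if j = n then \<phi> n z0 * of_real
      (\<integral>u. indicator (cball (0::complex) r) u * norm u ^ (2 * n) \<partial>lborel) else 0)"
  proof (rule sum.cong)
    fix j assume "j \<in> {..n}"
    then have j: "j \<le> n" by simp
    have "(\<Sum>k\<le>j. c j k * (\<integral>u. I j k u \<partial>lborel)) = (\<Sum>k\<le>j. if k = n then c j k * (\<phi> j z0 * of_real
        (\<integral>u. indicator (cball (0::complex) r) u * norm u ^ (2 * n) \<partial>lborel)) else 0)"
      using integral_cball_cnj_power_mult_holomorphic[OF hol'[OF j] r] j
      by (intro sum.cong) (auto simp: I_def)
    then show "(\<Sum>k\<le>j. c j k * (\<integral>u. I j k u \<partial>lborel)) = (if j = n then \<phi> n z0 * of_real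
        (\<integral>u. indicator (cball (0::complex) r) u * norm u ^ (2 * n) \<partial>lborel) else 0)"
      using j by (auto simp: c_def)
  qed simp
  finally show ?thesis unfolding eq by simp
qed

lemma integral_cball_power_pos:
  assumes "0 < r"
  shows "(\<integral>u. indicator (cball (0::complex) r) u * norm u ^ m \<partial>lborel) > 0"
proof -
  \<comment> \<open>On this annulus of positive area the integrand is at least
    \<open>(r / 2) ^ m\<close>.\<close>
  let ?A = "cball (0::complex) r - ball 0 (r / 2)"
  have "measure lborel ?A = pi * r\<^sup>2 - pi * (r / 2)\<^sup>2"
    using assms by (subst measure_Diff) (auto simp: content_cball content_ball unit_ball_vol_2 emeasure_cball)
  also have "\<dots> > 0" using assms by (simp add: power_divide)
  finally have A: "measure lborel ?A > 0" .
  have int: "integrable lborel (\<lambda>u. indicator (cball (0::complex) r) u * norm u ^ m)"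
    using borel_integrable_compact[of "cball (0::complex) r" "\<lambda>u. norm u ^ m"]
    by (auto intro!: continuous_intros)
  have "0 < (r / 2) ^ m * measure lborel ?A" using A assms by simp
  also have "\<dots> = (\<integral>u. (r / 2) ^ m * indicator ?A u \<partial>lborel)"
    by simp
  also have "\<dots> \<le> (\<integral>u. indicator (cball (0::complex) r) u * norm u ^ m \<partial>lborel)"
  proof (rule integral_mono[OF _ int])
    show "integrable lborel (\<lambda>u. (r / 2) ^ m * indicator ?A u)"
      using assms by (intro integrable_mult_right integrable_real_indicator)
        (auto intro: le_less_trans[OF emeasure_mono[of _ "cball 0 r"]] simp: emeasure_cball)
    show "(r / 2) ^ m * indicator ?A u \<le> indicator (cball (0::complex) r) u * norm u ^ m" for u
      using assms by (auto simp: indicator_def power_mono)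
  qed
  finally show ?thesis .
qed

text \<open>Keeps the coefficients as explicit data, so that bounds and limits can be stated for
  them. The index \<open>k\<close> counts coefficients: functions of order \<open>n + 1\<close> are
  \<open>cnj_poly (Suc n) \<phi>\<close>.\<close>

definition cnj_poly :: "nat \<Rightarrow> (nat \<Rightarrow> complex \<Rightarrow> complex) \<Rightarrow> complex \<Rightarrow> complex" where
  "cnj_poly k \<phi> z = (\<Sum>j<k. cnj z ^ j * \<phi> j z)"

lemma continuous_on_cnj_poly:
  assumes "\<And>j. j < k \<Longrightarrow> \<phi> j holomorphic_on S"
  shows "continuous_on S (cnj_poly k \<phi>)"
  unfolding cnj_poly_def[abs_def]
  by (intro continuous_intros holomorphic_on_imp_continuous_on assms) simp

text \<open>The constant is the reciprocal of the moment over a disc of radius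
  \<open>R' - R\<close>. That disc fits around every \<open>z\<close> with
  \<open>norm z \<le> R\<close>, so one constant serves all points and all coefficient families. Its
  radius is at most 1, which bounds the factor \<open>norm u ^ n\<close> by 1.\<close>

lemma leading_coeff_bound:
  assumes "0 \<le> R" "R < R'" "R' < 1"
  obtains C where "C \<ge> 0" "\<And>\<phi> z. (\<And>j. j \<le> n \<Longrightarrow> \<phi> j holomorphic_on \<D>) \<Longrightarrow> norm z \<le> R \<Longrightarrow>
    norm (\<phi> n z) \<le> C * (\<integral>w. indicator (cball 0 R') w * norm (cnj_poly (Suc n) \<phi> w) \<partial>lborel)"
proof
  define r where "r = R' - R"
  define I where "I = (\<integral>u. indicator (cball (0::complex) r) u * norm u ^ (2 * n) \<partial>lborel)"
  have r: "r > 0" "r \<le> 1" using assms by (auto simp: r_def)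
  have I: "I > 0" unfolding I_def using r by (intro integral_cball_power_pos)
  show "1 / I \<ge> 0" using I by simp
  fix \<phi> :: "nat \<Rightarrow> complex \<Rightarrow> complex" and z :: complex
  assume hol: "\<And>j. j \<le> n \<Longrightarrow> \<phi> j holomorphic_on \<D>" and z: "norm z \<le> R"
  let ?F = "cnj_poly (Suc n) \<phi>"
  have cont: "continuous_on \<D> ?F" using hol by (intro continuous_on_cnj_poly) auto
  have int: "integrable lborel (\<lambda>w. indicator K w * norm (?F w))" if "compact K" "K \<subseteq> \<D>" for K
    using borel_integrable_compact[of K "\<lambda>w. norm (?F w)"] that cont
    by (auto intro!: continuous_intros intro: continuous_on_subset)
  have sub: "cball z r \<subseteq> cball 0 R'"
    using z by (subst cball_subset_cball_iff) (auto simp: r_def dist_norm norm_minus_commute)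
  have sub': "cball 0 R' \<subseteq> \<D>" using assms by auto
  have "norm (\<phi> n z) * I = norm (\<phi> n z * of_real I)"
    using I by (simp add: norm_mult)
  also have "\<phi> n z * of_real I = (\<integral>u. indicator (cball 0 r) u *\<^sub>R (u ^ n * ?F (z + u)) \<partial>lborel)"
    unfolding I_def cnj_poly_def lessThan_Suc_atMost
  proof (rule integral_cball_leading_coeff[symmetric])
    show "\<phi> j holomorphic_on ball z (1 - norm z)" if "j \<le> n" for j
      by (rule holomorphic_on_subset[OF hol[OF that]]) (auto simp: ball_subset_ball_iff dist_norm norm_minus_commute)
  qed (use r z assms in \<open>auto simp: r_def\<close>)
  also have "norm \<dots> \<le> (\<integral>u. norm (indicator (cball 0 r) u *\<^sub>R (u ^ n * ?F (z + u))) \<partial>lborel)"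
    by (rule integral_norm_bound)
  also have "\<dots> \<le> (\<integral>u. indicator (cball z r) (z + u) * norm (?F (z + u)) \<partial>lborel)"
  proof (rule integral_mono')
    show "norm (indicator (cball 0 r) u *\<^sub>R (u ^ n * ?F (z + u)))
        \<le> indicator (cball z r) (z + u) * norm (?F (z + u))" for u
      using r by (auto simp: indicator_def norm_mult norm_power dist_norm
          intro!: mult_left_le_one_le power_le_one)
    have "integrable (distr lborel borel ((+) z)) (\<lambda>w. indicator (cball z r) w * norm (?F w))"
      using int[of "cball z r"] sub sub' by (simp add: lborel_distr_plus)
    then show "integrable lborel (\<lambda>u. indicator (cball z r) (z + u) * norm (?F (z + u)))"
      by (rule integrable_distr[rotated]) simp
  qed simp
  also have "\<dots> = (\<integral>w. indicator (cball z r) w * norm (?F w) \<partial>lborel)"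
    using int[of "cball z r"] sub sub'
    by (intro integral_lborel_translate[of "\<lambda>w. indicator (cball z r) w * norm (?F w)"])
      (auto dest: borel_measurable_integrable)
  also have "\<dots> \<le> (\<integral>w. indicator (cball 0 R') w * norm (?F w) \<partial>lborel)"
    using int[of "cball 0 R'"] sub sub' by (intro integral_mono') (auto simp: indicator_def)
  finally show "norm (\<phi> n z) \<le> 1 / I * (\<integral>w. indicator (cball 0 R') w * norm (?F w) \<partial>lborel)"
    using I by (simp add: pos_le_divide_eq)
qed

text \<open>Bounding the lower coefficients takes the integral of the function minus its top term
  over some disc, hence the top coefficient on that whole disc, which in turn costs a larger disc
  for the function. So \<open>R\<close> stays fixed, and the induction generalises the outer radius
  \<open>R'\<close> and inserts \<open>R1\<close> halfway.\<close>

lemma coeff_bound: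
  assumes "0 \<le> R" "R < R'" "R' < 1"
  shows "\<exists>C\<ge>0. \<forall>\<phi>. (\<forall>j<k. \<phi> j holomorphic_on \<D>) \<longrightarrow> (\<forall>j<k. \<forall>z\<in>cball 0 R.
    norm (\<phi> j z) \<le> C * (\<integral>w. indicator (cball 0 R') w * norm (cnj_poly k \<phi> w) \<partial>lborel))"
  using assms(2,3)
proof (induction k arbitrary: R')
  case (Suc k)
  define R1 where "R1 = (R + R') / 2"
  have R1: "0 \<le> R1" "R < R1" "R1 < R'" "R1 < 1" using Suc.prems assms(1) by (auto simp: R1_def)
  obtain C0 where C0: "C0 \<ge> 0" "\<And>\<phi> j z. (\<And>j. j < k \<Longrightarrow> \<phi> j holomorphic_on \<D>) \<Longrightarrow> j < k \<Longrightarrow> norm z \<le> R \<Longrightarrow>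
      norm (\<phi> j z) \<le> C0 * (\<integral>w. indicator (cball 0 R1) w * norm (cnj_poly k \<phi> w) \<partial>lborel)"
    using Suc.IH[OF R1(2,4)] by (metis mem_cball_0)
  obtain C1 where C1: "C1 \<ge> 0" "\<And>\<phi> z. (\<And>j. j \<le> k \<Longrightarrow> \<phi> j holomorphic_on \<D>) \<Longrightarrow> norm z \<le> R1 \<Longrightarrow>
    norm (\<phi> k z) \<le> C1 * (\<integral>w. indicator (cball 0 R') w * norm (cnj_poly (Suc k) \<phi> w) \<partial>lborel)"
    using leading_coeff_bound[OF R1(1,3) Suc.prems(2)] by metis
  define A where "A = (\<integral>w. indicator (cball (0::complex) R1) w \<partial>lborel :: real)"
  have A: "A \<ge> 0" by (simp add: A_def)
  \<comment> \<open>\<open>C1\<close> serves the top coefficient. For the others, the integral of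
    the remainder over \<open>cball 0 R1\<close> is at most \<open>1 + C1 * A\<close> times that of
    the function: its top term contributes the area \<open>A\<close> times
    \<open>C1\<close>.\<close>
  define C where "C = max C1 (C0 * (1 + C1 * A))"
  have "norm (\<phi> j z) \<le> C * (\<integral>w. indicator (cball 0 R') w * norm (cnj_poly (Suc k) \<phi> w) \<partial>lborel)"
    if hol: "\<And>j. j < Suc k \<Longrightarrow> \<phi> j holomorphic_on \<D>" and j: "j < Suc k" and z: "norm z \<le> R" for \<phi> j z
  proof -
    let ?F = "cnj_poly (Suc k) \<phi>" and ?G = "cnj_poly k \<phi>"
    define N where "N = (\<integral>w. indicator (cball 0 R') w * norm (?F w) \<partial>lborel)"
    have N: "N \<ge> 0" unfolding N_def by (intro integral_nonneg_AE) auto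
    have int: "integrable lborel (\<lambda>w. indicator (cball 0 \<rho>) w * norm (?F w))" if "\<rho> < 1" for \<rho>
    proof -
      have "continuous_on (cball 0 \<rho>) ?F"
        by (rule continuous_on_subset[OF continuous_on_cnj_poly[OF hol]]) (use that in auto)
      then show ?thesis
        using borel_integrable_compact[of "cball 0 \<rho>" "\<lambda>w. norm (?F w)"]
        by (auto intro!: continuous_intros)
    qed
    have top: "norm (\<phi> k w) \<le> C1 * N" if "norm w \<le> R1" for w
      unfolding N_def using hol that by (intro C1) auto
    show ?thesis
    proof (cases "j = k")
      case True
      have "norm (\<phi> j z) \<le> C1 * N" using top z R1 True by auto
      also have "\<dots> \<le> C * N" using N by (intro mult_right_mono) (auto simp: C_def)
      finally show ?thesis by (simp add: N_def)
    next
      case False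
      have "(\<integral>w. indicator (cball 0 R1) w * norm (?G w) \<partial>lborel)
          \<le> (\<integral>w. indicator (cball 0 R') w * norm (?F w) + indicator (cball 0 R1) w * (C1 * N) \<partial>lborel)"
      proof (rule integral_mono')
        show "integrable lborel (\<lambda>w. indicator (cball 0 R') w * norm (?F w) + indicator (cball 0 R1) w * (C1 * N))"
          using int[OF Suc.prems(2)] by (intro Bochner_Integration.integrable_add integrable_mult_left)
            (auto simp: emeasure_cball R1)
        fix w :: complex
        show "indicator (cball 0 R1) w * norm (?G w)
            \<le> indicator (cball 0 R') w * norm (?F w) + indicator (cball 0 R1) w * (C1 * N)"
        proof (cases "norm w \<le> R1")
          case True
          have "?G w = ?F w - cnj w ^ k * \<phi> k w" by (simp add: cnj_poly_def)
          then have "norm (?G w) \<le> norm (?F w) + norm (cnj w ^ k * \<phi> k w)"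
            using norm_triangle_ineq4 by metis
          also have "norm (cnj w ^ k * \<phi> k w) \<le> 1 * norm (\<phi> k w)"
            unfolding norm_mult norm_power complex_mod_cnj
            using True R1 by (intro mult_right_mono power_le_one) auto
          also have "\<dots> \<le> C1 * N" using top True by simp
          finally show ?thesis using True R1 by simp
        qed simp
      qed (use C1(1) N in simp)
      also have "\<dots> = N + A * (C1 * N)"
        using int[OF Suc.prems(2)] R1 by (simp add: N_def A_def emeasure_cball)
      finally have *: "(\<integral>w. indicator (cball 0 R1) w * norm (?G w) \<partial>lborel) \<le> N + A * (C1 * N)" .
      have "norm (\<phi> j z) \<le> C0 * (\<integral>w. indicator (cball 0 R1) w * norm (?G w) \<partial>lborel)"
        using hol j False z by (intro C0) auto
      also have "\<dots> \<le> C0 * (N + A * (C1 * N))"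
        using C0(1) by (intro mult_left_mono *)
      also have "\<dots> = C0 * (1 + C1 * A) * N" by (simp add: algebra_simps)
      also have "\<dots> \<le> C * N" using N by (intro mult_right_mono) (auto simp: C_def)
      finally show ?thesis by (simp add: N_def)
    qed
  qed
  moreover have "C \<ge> 0" using C1(1) by (simp add: C_def)
  ultimately show ?case by (intro exI[of _ C]) auto
qed auto

lemma integral_cball_le_disc_measure:
  fixes f :: "complex \<Rightarrow> real"
  assumes R: "0 \<le> R" "R < 1" and cont: "continuous_on \<D> f" and f: "\<And>z. f z \<ge> 0"
    and int: "integrable (\<mu> \<gamma>) f"
  shows "(\<integral>z. indicator (cball 0 R) z * f z \<partial>lborel) \<le> (\<integral>z. f z \<partial>\<mu> \<gamma>) / min 1 ((1 - R\<^sup>2) powr \<gamma>)"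
proof -
  \<comment> \<open>Lower bound of the weight on the disc: for \<open>\<gamma> \<ge> 0\<close> the
    weight is smallest at the rim, for \<open>\<gamma> < 0\<close> at the centre, where it is
    1.\<close>
  define m where "m = min 1 ((1 - R\<^sup>2) powr \<gamma>)"
  have R2: "1 - R\<^sup>2 > 0" using R by (simp add: abs_square_less_1)
  then have m: "m > 0" by (simp add: m_def)
  have sub: "cball 0 R \<subseteq> (\<D> :: complex set)" using R by auto
  have cont': "continuous_on (cball 0 R) f" using cont sub by (rule continuous_on_subset)
  let ?g = "\<lambda>z. indicator (cball 0 R) z * f z"
  have g: "integrable lborel ?g"
    using borel_integrable_compact[OF _ cont'] by simp
  have pos: "1 - (norm z)\<^sup>2 > 0" if "z \<in> cball 0 R" for z :: complex
    using that R by (simp add: abs_square_less_1)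
  have "integrable lborel (\<lambda>z. indicator (cball 0 R) z *\<^sub>R ((1 - (norm z)\<^sup>2) powr \<gamma> * f z))"
    using pos by (intro borel_integrable_compact continuous_intros cont') force+
  also have "(\<lambda>z. indicator (cball 0 R) z *\<^sub>R ((1 - (norm z)\<^sup>2) powr \<gamma> * f z)) = (\<lambda>z. disc_weight \<gamma> (norm z) *\<^sub>R ?g z)"
    using R by (auto simp: disc_weight_def indicator_def)
  finally have wg: "integrable lborel (\<lambda>z. disc_weight \<gamma> (norm z) *\<^sub>R ?g z)" .
  have "m * (\<integral>z. ?g z \<partial>lborel) = (\<integral>z. m * ?g z \<partial>lborel)" by simp
  also have "\<dots> \<le> (\<integral>z. disc_weight \<gamma> (norm z) *\<^sub>R ?g z \<partial>lborel)"
  proof (intro integral_mono wg integrable_mult_right g)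
    fix z :: complex
    have "m \<le> disc_weight \<gamma> (norm z)" if z: "norm z \<le> R"
    proof (cases "\<gamma> \<ge> 0")
      case True
      have "(1 - R\<^sup>2) powr \<gamma> \<le> (1 - (norm z)\<^sup>2) powr \<gamma>"
        using True R2 z by (intro powr_mono2) (auto intro: power_mono)
      then show ?thesis using z R by (auto simp: m_def disc_weight_def)
    next
      case False
      have "1 powr \<gamma> \<le> (1 - (norm z)\<^sup>2) powr \<gamma>"
        using False pos[of z] z by (intro powr_mono2') auto
      then show ?thesis using z R by (auto simp: m_def disc_weight_def)
    qed
    then show "m * ?g z \<le> disc_weight \<gamma> (norm z) *\<^sub>R ?g z"
      using f[of z] by (auto simp: indicator_def intro: mult_right_mono)
  qed
  also have "\<dots> = (\<integral>z. ?g z \<partial>\<mu> \<gamma>)"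
    using g by (intro integral_disc_measure[symmetric]) (auto dest: borel_measurable_integrable)
  also have "\<dots> \<le> (\<integral>z. f z \<partial>\<mu> \<gamma>)"
    using int f by (intro integral_mono') (auto simp: indicator_def)
  finally show ?thesis using m by (simp add: m_def pos_le_divide_eq mult.commute)
qed

text \<open>Area integrals over smaller discs are dominated by the weighted L1 norm, and that by the
  L2 norm. This is the analogue of the continuity of point evaluations on a Bergman space, for each
  coefficient separately and uniformly in \<open>norm z \<le> R\<close>.\<close>

lemma coeff_bound_L2:
  assumes "\<gamma> > -1" "0 \<le> R" "R < 1"
  obtains C where "C \<ge> 0" "\<And>\<phi> j z. (\<And>j. j < k \<Longrightarrow> \<phi> j holomorphic_on \<D>) \<Longrightarrow> cnj_poly k \<phi> \<in> L2 \<gamma> \<Longrightarrow>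
    j < k \<Longrightarrow> norm z \<le> R \<Longrightarrow> norm (\<phi> j z) \<le> C * L2_norm \<gamma> (cnj_poly k \<phi>)"
proof -
  define R' where "R' = (R + 1) / 2"
  have R': "R < R'" "R' < 1" "0 \<le> R'" using assms by (auto simp: R'_def)
  obtain C0 where C0: "C0 \<ge> 0" "\<And>\<phi> j z. (\<And>j. j < k \<Longrightarrow> \<phi> j holomorphic_on \<D>) \<Longrightarrow> j < k \<Longrightarrow> norm z \<le> R \<Longrightarrow>
      norm (\<phi> j z) \<le> C0 * (\<integral>w. indicator (cball 0 R') w * norm (cnj_poly k \<phi> w) \<partial>lborel)"
    using coeff_bound[OF assms(2) R'(1,2), of k] by (metis mem_cball_0)
  define m where "m = min 1 ((1 - R'\<^sup>2) powr \<gamma>)"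
  have "1 - R'\<^sup>2 > 0" using R' by (simp add: abs_square_less_1)
  then have m: "m > 0" by (simp add: m_def)
  define K where "K = (measure (\<mu> \<gamma>) \<D> + 1) / 2"
  have K: "K \<ge> 0" by (simp add: K_def)
  show ?thesis
  proof
    show "C0 * (K / m) \<ge> 0" using C0(1) K m by simp
    fix \<phi> :: "nat \<Rightarrow> complex \<Rightarrow> complex" and j and z :: complex
    assume hol: "\<And>j. j < k \<Longrightarrow> \<phi> j holomorphic_on \<D>" and L2: "cnj_poly k \<phi> \<in> L2 \<gamma>"
      and j: "j < k" "norm z \<le> R"
    have cont: "continuous_on \<D> (cnj_poly k \<phi>)" using hol by (rule continuous_on_cnj_poly)
    have "(\<integral>w. indicator (cball 0 R') w * norm (cnj_poly k \<phi> w) \<partial>lborel)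
        \<le> (\<integral>w. norm (cnj_poly k \<phi> w) \<partial>\<mu> \<gamma>) / m"
      unfolding m_def using cont L2_integrable_norm(1)[OF assms(1) L2] R'
      by (intro integral_cball_le_disc_measure continuous_intros) auto
    also have "\<dots> \<le> (K * L2_norm \<gamma> (cnj_poly k \<phi>)) / m"
      using L2_integrable_norm(2)[OF assms(1) L2] m by (intro divide_right_mono) (auto simp: K_def)
    finally have "C0 * (\<integral>w. indicator (cball 0 R') w * norm (cnj_poly k \<phi> w) \<partial>lborel)
        \<le> C0 * ((K * L2_norm \<gamma> (cnj_poly k \<phi>)) / m)"
      using C0(1) by (rule mult_left_mono)
    moreover have "norm (\<phi> j z) \<le> C0 * (\<integral>w. indicator (cball 0 R') w * norm (cnj_poly k \<phi> w) \<partial>lborel)"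
      using hol j by (rule C0(2))
    ultimately show "norm (\<phi> j z) \<le> C0 * (K / m) * L2_norm \<gamma> (cnj_poly k \<phi>)" by simp
  qed
qed

section \<open>The poly-Bergman space is closed\<close>

lemma poly_bergman_iff:
  "F \<in> poly_bergman \<gamma> n \<longleftrightarrow> F \<in> L2 \<gamma> \<and> (\<exists>\<phi>. (\<forall>j<Suc n. \<phi> j holomorphic_on \<D>) \<and>
    (AE z in \<mu> \<gamma>. F z = cnj_poly (Suc n) \<phi> z))"
proof -
  have "(\<exists>G. polyanalytic_on (n + 1) G \<D> \<and> (AE z in \<mu> \<gamma>. F z = G z)) \<longleftrightarrow>
    (\<exists>\<phi>. (\<forall>j<Suc n. \<phi> j holomorphic_on \<D>) \<and> (AE z in \<mu> \<gamma>. F z = cnj_poly (Suc n) \<phi> z))"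
  proof
    assume "\<exists>G. polyanalytic_on (n + 1) G \<D> \<and> (AE z in \<mu> \<gamma>. F z = G z)"
    then obtain G where G: "polyanalytic_on (Suc n) G \<D>" and FG: "AE z in \<mu> \<gamma>. F z = G z"
      by auto
    obtain \<phi> where \<phi>: "\<And>j. j < Suc n \<Longrightarrow> \<phi> j holomorphic_on \<D>"
      "\<And>z. z \<in> \<D> \<Longrightarrow> G z = (\<Sum>j<Suc n. cnj z ^ j * \<phi> j z)"
      using polyanalytic_onE[OF open_ball G] by metis
    have "AE z in \<mu> \<gamma>. F z = cnj_poly (Suc n) \<phi> z"
      using FG AE_space
    proof eventually_elim
      case (elim z)
      then show ?case using \<phi>(2)[of z] by (simp only: cnj_poly_def space_disc_measure)
    qed
    with \<phi>(1) show "\<exists>\<phi>. (\<forall>j<Suc n. \<phi> j holomorphic_on \<D>) \<and>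
        (AE z in \<mu> \<gamma>. F z = cnj_poly (Suc n) \<phi> z)" by blast
  next
    assume "\<exists>\<phi>. (\<forall>j<Suc n. \<phi> j holomorphic_on \<D>) \<and> (AE z in \<mu> \<gamma>. F z = cnj_poly (Suc n) \<phi> z)"
    then obtain \<phi> where \<phi>: "\<And>j. j < Suc n \<Longrightarrow> \<phi> j holomorphic_on \<D>"
      "AE z in \<mu> \<gamma>. F z = cnj_poly (Suc n) \<phi> z" by blast
    have "polyanalytic_on (Suc n) (cnj_poly (Suc n) \<phi>) \<D>"
      using \<phi>(1) by (rule polyanalytic_on_sum_cnj_power[OF open_ball]) (simp_all only: cnj_poly_def)
    then show "\<exists>G. polyanalytic_on (n + 1) G \<D> \<and> (AE z in \<mu> \<gamma>. F z = G z)"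
      using \<phi>(2) unfolding Suc_eq_plus1 by blast
  qed
  then show ?thesis by (simp only: poly_bergman_def mem_Collect_eq)
qed

lemma subspace_poly_bergman: "cfun.subspace (poly_bergman \<gamma> n)"
  unfolding cfun.subspace_def
proof (intro conjI ballI allI)
  show "0 \<in> poly_bergman \<gamma> n"
    unfolding poly_bergman_iff
    by (intro conjI L2_zero exI[of _ "\<lambda>j z. 0"]) (simp_all add: cnj_poly_def)
next
  fix F G assume "F \<in> poly_bergman \<gamma> n" "G \<in> poly_bergman \<gamma> n"
  then obtain \<phi> \<psi> where F: "F \<in> L2 \<gamma>" "\<And>j. j < Suc n \<Longrightarrow> \<phi> j holomorphic_on \<D>"
      "AE z in \<mu> \<gamma>. F z = cnj_poly (Suc n) \<phi> z"
    and G: "G \<in> L2 \<gamma>" "\<And>j. j < Suc n \<Longrightarrow> \<psi> j holomorphic_on \<D>"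
      "AE z in \<mu> \<gamma>. G z = cnj_poly (Suc n) \<psi> z"
    unfolding poly_bergman_iff by blast
  have "AE z in \<mu> \<gamma>. (F + G) z = cnj_poly (Suc n) (\<lambda>j z. \<phi> j z + \<psi> j z) z"
    using F(3) G(3) by eventually_elim (simp add: cnj_poly_def distrib_left sum.distrib)
  then show "F + G \<in> poly_bergman \<gamma> n"
    unfolding poly_bergman_iff using F G
    by (intro conjI L2_add exI[of _ "\<lambda>j z. \<phi> j z + \<psi> j z"] allI impI holomorphic_intros) auto
next
  fix c F assume "F \<in> poly_bergman \<gamma> n"
  then obtain \<phi> where F: "F \<in> L2 \<gamma>" "\<And>j. j < Suc n \<Longrightarrow> \<phi> j holomorphic_on \<D>"
      "AE z in \<mu> \<gamma>. F z = cnj_poly (Suc n) \<phi> z"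
    unfolding poly_bergman_iff by blast
  have "AE z in \<mu> \<gamma>. cscale c F z = cnj_poly (Suc n) (\<lambda>j z. c * \<phi> j z) z"
    using F(3) by eventually_elim (simp add: cnj_poly_def cscale_def sum_distrib_left distrib_left mult.left_commute)
  then show "cscale c F \<in> poly_bergman \<gamma> n"
    unfolding poly_bergman_iff using F
    by (intro conjI L2_cscale exI[of _ "\<lambda>j z. c * \<phi> j z"] allI impI holomorphic_intros) auto
qed

lemma cnj_poly_diff: "cnj_poly k (\<lambda>j z. \<phi> j z - \<psi> j z) = cnj_poly k \<phi> - cnj_poly k \<psi>"
  by (rule ext) (simp add: cnj_poly_def right_diff_distrib sum_subtractf)

text \<open>The candidate limit is built from the coefficients: the bound, applied to differences,
  makes each coefficient sequence uniformly Cauchy on every \<open>cball 0 R\<close> with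
  \<open>R < 1\<close>. Only pointwise convergence on the disc is claimed; the relation to the
  seminorm is left to Fatou's lemma.\<close>

lemma cnj_poly_L2_Cauchy_limit:
  assumes "\<gamma> > -1" and hol: "\<And>i j. j < k \<Longrightarrow> \<phi> i j holomorphic_on \<D>"
    and L2: "\<And>i. cnj_poly k (\<phi> i) \<in> L2 \<gamma>"
    and Cauchy: "\<And>e. e > 0 \<Longrightarrow> \<exists>M. \<forall>i\<ge>M. \<forall>l\<ge>M. L2_norm \<gamma> (cnj_poly k (\<phi> i) - cnj_poly k (\<phi> l)) < e"
  obtains \<psi> where "\<And>j. j < k \<Longrightarrow> \<psi> j holomorphic_on \<D>"
    and "\<And>z. z \<in> \<D> \<Longrightarrow> (\<lambda>i. cnj_poly k (\<phi> i) z) \<longlonglongrightarrow> cnj_poly k \<psi> z"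
proof -
  define \<psi> where "\<psi> = (\<lambda>j z. lim (\<lambda>i. \<phi> i j z))"
  have unif: "uniform_limit (cball 0 R) (\<lambda>i. \<phi> i j) (\<psi> j) sequentially" if R: "0 \<le> R" "R < 1" and j: "j < k" for R j
  proof -
    obtain C where C: "C \<ge> 0" "\<And>\<phi> j z. (\<And>j. j < k \<Longrightarrow> \<phi> j holomorphic_on \<D>) \<Longrightarrow> cnj_poly k \<phi> \<in> L2 \<gamma> \<Longrightarrow>
        j < k \<Longrightarrow> norm z \<le> R \<Longrightarrow> norm (\<phi> j z) \<le> C * L2_norm \<gamma> (cnj_poly k \<phi>)"
      using coeff_bound_L2[OF assms(1) R, of k] by metis
    have le: "dist (\<phi> i j z) (\<phi> l j z) \<le> C * L2_norm \<gamma> (cnj_poly k (\<phi> i) - cnj_poly k (\<phi> l))"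
      if "norm z \<le> R" for i l z
      using C(2)[of "\<lambda>j z. \<phi> i j z - \<phi> l j z" j z] hol L2 that j
      by (auto simp: cnj_poly_diff dist_norm L2_diff intro!: holomorphic_intros)
    have "uniformly_Cauchy_on (cball 0 R) (\<lambda>i. \<phi> i j)"
      unfolding uniformly_Cauchy_on_def
    proof (intro allI impI)
      fix e :: real assume "e > 0"
      \<comment> \<open>The denominator is \<open>C + 1\<close> because \<open>C\<close> may be
        0.\<close>
      then have "e / (C + 1) > 0" using C(1) by simp
      from Cauchy[OF this] obtain M where M: "\<And>i l. i \<ge> M \<Longrightarrow> l \<ge> M \<Longrightarrow>
          L2_norm \<gamma> (cnj_poly k (\<phi> i) - cnj_poly k (\<phi> l)) < e / (C + 1)" by blast
      have "dist (\<phi> i j z) (\<phi> l j z) < e" if "z \<in> cball 0 R" "i \<ge> M" "l \<ge> M" for z i l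
      proof -
        have "dist (\<phi> i j z) (\<phi> l j z) \<le> C * L2_norm \<gamma> (cnj_poly k (\<phi> i) - cnj_poly k (\<phi> l))"
          using that by (intro le) simp
        also have "\<dots> \<le> C * (e / (C + 1))" using M[OF that(2,3)] C(1) by (intro mult_left_mono) auto
        also have "\<dots> < e" using C(1) \<open>e > 0\<close> by (simp add: divide_less_eq algebra_simps)
        finally show ?thesis .
      qed
      then show "\<exists>M. \<forall>x\<in>cball 0 R. \<forall>m\<ge>M. \<forall>n\<ge>M. dist (\<phi> m j x) (\<phi> n j x) < e" by blast
    qed
    then have "uniformly_convergent_on (cball 0 R) (\<lambda>i. \<phi> i j)"
      by (rule Cauchy_uniformly_convergent)
    then show ?thesis unfolding uniformly_convergent_uniform_limit_iff \<psi>_def .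
  qed
  show thesis
  proof (rule that)
    show "\<psi> j holomorphic_on \<D>" if j: "j < k" for j
    proof (rule holomorphic_uniform_sequence[OF open_ball hol[OF j]])
      fix x :: complex assume x: "x \<in> \<D>"
      \<comment> \<open>Half the distance to the boundary, so that \<open>cball x d\<close> lies in
        a disc around 0 of radius below 1, where the uniform limit is known.\<close>
      define d where "d = (1 - norm x) / 2"
      have sub: "cball x d \<subseteq> cball 0 (norm x + d)"
        by (subst cball_subset_cball_iff) (simp add: dist_norm)
      have d: "d > 0" "norm x + d < 1" using x by (auto simp: d_def field_simps)
      have "uniform_limit (cball x d) (\<lambda>i. \<phi> i j) (\<psi> j) sequentially"
        by (rule uniform_limit_on_subset[OF unif sub]) (use d j in auto)
      moreover have "cball x d \<subseteq> \<D>" using sub d by auto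
      ultimately show "\<exists>d>0. cball x d \<subseteq> \<D> \<and> uniform_limit (cball x d) (\<lambda>i. \<phi> i j) (\<psi> j) sequentially"
        using d by blast
    qed
    fix z :: complex assume z: "z \<in> \<D>"
    have "(\<lambda>i. \<phi> i j z) \<longlonglongrightarrow> \<psi> j z" if "j < k" for j
      by (rule tendsto_uniform_limitI[OF unif[of "norm z"]]) (use z that in auto)
    then show "(\<lambda>i. cnj_poly k (\<phi> i) z) \<longlonglongrightarrow> cnj_poly k \<psi> z"
      unfolding cnj_poly_def by (intro tendsto_intros) auto
  qed
qed

lemma closure_of_poly_bergman_subset:
  assumes "\<gamma> > -1"
  shows "L2_topology \<gamma> closure_of poly_bergman \<gamma> n \<subseteq> poly_bergman \<gamma> n"
proof
  fix F assume "F \<in> L2_topology \<gamma> closure_of poly_bergman \<gamma> n"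
  then have F: "F \<in> L2 \<gamma>" and "\<forall>i. \<exists>G\<in>poly_bergman \<gamma> n. G \<in> L2 \<gamma> \<and> L2_norm \<gamma> (G - F) < inverse (real (Suc i))"
    unfolding L2_topology_closure_of by auto
  then obtain Fi where Fi: "\<And>i. Fi i \<in> poly_bergman \<gamma> n" "\<And>i. Fi i \<in> L2 \<gamma>"
    "\<And>i. L2_norm \<gamma> (Fi i - F) < inverse (real (Suc i))" by metis
  have "\<forall>i. \<exists>\<phi>. (\<forall>j<Suc n. \<phi> j holomorphic_on \<D>) \<and> (AE z in \<mu> \<gamma>. Fi i z = cnj_poly (Suc n) \<phi> z)"
    using Fi(1) unfolding poly_bergman_iff by blast
  then obtain \<phi> where hol: "\<And>i j. j < Suc n \<Longrightarrow> \<phi> i j holomorphic_on \<D>"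
    and AE: "\<And>i. AE z in \<mu> \<gamma>. Fi i z = cnj_poly (Suc n) (\<phi> i) z" by metis
  define P where "P = (\<lambda>i. cnj_poly (Suc n) (\<phi> i))"
  have P_meas: "P i \<in> borel_measurable (\<mu> \<gamma>)" for i
    unfolding P_def using hol
    by (intro borel_measurable_disc_measure_continuous continuous_on_cnj_poly)
  have P_L2: "P i \<in> L2 \<gamma>" for i
    using L2_cong_AE(1)[OF Fi(2)[of i] P_meas[of i]] AE[of i] by (simp add: P_def)
  have ev: "eventually (\<lambda>i. L2_norm \<gamma> (Fi i - F) \<le> e) sequentially" if e: "e > 0" for e
  proof -
    obtain M where M: "inverse (real (Suc M)) < e" using reals_Archimedean[OF e] by blast
    show ?thesis
    proof (rule eventually_sequentiallyI[of M])
      fix i assume "M \<le> i"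
      then have "inverse (real (Suc i)) \<le> inverse (real (Suc M))" by (intro le_imp_inverse_le) auto
      with M Fi(3)[of i] show "L2_norm \<gamma> (Fi i - F) \<le> e" by linarith
    qed
  qed
  have "\<exists>M. \<forall>i\<ge>M. \<forall>l\<ge>M. L2_norm \<gamma> (P i - P l) < e" if e: "e > 0" for e
  proof -
    obtain M where M: "\<And>i. i \<ge> M \<Longrightarrow> L2_norm \<gamma> (Fi i - F) \<le> e / 3"
      using ev[of "e / 3"] e by (auto simp: eventually_sequentially)
    have "L2_norm \<gamma> (P i - P l) < e" if "i \<ge> M" "l \<ge> M" for i l
    proof -
      have "AE z in \<mu> \<gamma>. (Fi i - Fi l) z = (P i - P l) z"
        using AE[of i] AE[of l] by eventually_elim (simp add: P_def)
      moreover have "P i - P l \<in> borel_measurable (\<mu> \<gamma>)"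
        using L2_diff[OF P_L2[of i] P_L2[of l]] by (simp add: L2_def)
      ultimately have "L2_norm \<gamma> (P i - P l) = L2_norm \<gamma> (Fi i - Fi l)"
        using L2_cong_AE(2)[OF L2_diff[OF Fi(2)[of i] Fi(2)[of l]]] by blast
      also have "\<dots> \<le> L2_norm \<gamma> (Fi i - F) + L2_norm \<gamma> (Fi l - F)"
        using L2_norm_triangle_diff[OF Fi(2)[of i] F Fi(2)[of l]] by (simp add: L2_norm_minus_commute[of \<gamma> F])
      also have "\<dots> \<le> e / 3 + e / 3" using M that by (intro add_mono) auto
      finally show ?thesis using e by simp
    qed
    then show ?thesis by blast
  qed
  from cnj_poly_L2_Cauchy_limit[OF assms, of "Suc n" \<phi>, OF hol P_L2[unfolded P_def] this[unfolded P_def]]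
  obtain \<psi> where \<psi>: "\<And>j. j < Suc n \<Longrightarrow> \<psi> j holomorphic_on \<D>"
    "\<And>z. z \<in> \<D> \<Longrightarrow> (\<lambda>i. P i z) \<longlonglongrightarrow> cnj_poly (Suc n) \<psi> z"
    unfolding P_def by metis
  define G where "G = cnj_poly (Suc n) \<psi>"
  \<comment> \<open>The exceptional null sets, one for each \<open>i\<close>, are merged into a
    single one.\<close>
  have "AE z in \<mu> \<gamma>. \<forall>i. Fi i z = P i z" using AE by (simp add: AE_all_countable P_def)
  then have lim: "AE z in \<mu> \<gamma>. (\<lambda>i. (Fi i - F) z) \<longlonglongrightarrow> (G - F) z"
    using AE_space
  proof eventually_elim
    case (elim z)
    then have "z \<in> \<D>" by (simp only: space_disc_measure)
    from \<psi>(2)[OF this] elim(1) show ?case unfolding G_def by (auto intro!: tendsto_intros)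
  qed
  have "G \<in> borel_measurable (\<mu> \<gamma>)"
    unfolding G_def using \<psi>(1)
    by (intro borel_measurable_disc_measure_continuous continuous_on_cnj_poly)
  then have meas: "G - F \<in> borel_measurable (\<mu> \<gamma>)"
    using F by (auto simp: L2_def fun_diff_def)
  \<comment> \<open>The errors \<open>Fi i - F\<close> tend to 0 in norm and to \<open>G - F\<close>
    almost everywhere, so Fatou's lemma bounds the norm of \<open>G - F\<close> by every positive
    \<open>e\<close>.\<close>
  have GF: "G - F \<in> L2 \<gamma>" "L2_norm \<gamma> (G - F) \<le> e" if "e > 0" for e
    using L2_norm_Fatou[OF L2_diff[OF Fi(2) F] meas lim ev[OF that]] by blast+
  have "L2_norm \<gamma> (G - F) \<le> 0" by (rule field_le_epsilon) (use GF(2) in simp)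
  then have "L2_norm \<gamma> (G - F) = 0" using L2_norm_nonneg[of \<gamma> "G - F"] by linarith
  then have "AE z in \<mu> \<gamma>. (G - F) z = 0" 
    by (rule L2_norm_eq_0_AE[OF GF(1)[OF zero_less_one]])
  then have "AE z in \<mu> \<gamma>. F z = cnj_poly (Suc n) \<psi> z"
    by eventually_elim (simp add: G_def)
  with F \<psi>(1) show "F \<in> poly_bergman \<gamma> n" unfolding poly_bergman_iff by blast
qed

lemma closedin_poly_bergman:
  assumes "\<gamma> > -1"
  shows "closedin (L2_topology \<gamma>) (poly_bergman \<gamma> n)"
  using closure_of_poly_bergman_subset[OF assms]
  by (simp add: closure_of_subset_eq[symmetric] topspace_L2_topology poly_bergman_iff subset_iff)

section \<open>Disc polynomials and monomials\<close>

text \<open>In the expansion of \<open>(1 - w) ^ j\<close> the top power \<open>w ^ j\<close> has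
  sign \<open>(-1) ^ j\<close>, which cancels the alternating sign of the explicit formula. So
  \<open>c 0\<close> is a sum of positive numbers, the Pochhammer symbols being positive for
  \<open>\<gamma> > -1\<close>, and the leading monomial is really present.\<close>

lemma disc_poly_eq_sum_monomials:
  assumes "\<gamma> > -1"
  obtains c :: "nat \<Rightarrow> complex" where "c 0 \<noteq> 0"
    "\<And>z. disc_poly \<gamma> m k z = (\<Sum>p\<le>min m k. c p * (z ^ (m - p) * cnj z ^ (k - p)))"
proof
  define q where "q = min m k"
  define A :: "nat \<Rightarrow> complex" where "A = (\<lambda>j. fact m * fact k * (-1) ^ j
    / (fact j * of_real (pochhammer (\<gamma> + 1) j) * fact (m - j) * fact (k - j)))"
  define c where "c = (\<lambda>p. \<Sum>j\<le>q. if p \<le> j then A j * (of_nat (j choose p) * (-1) ^ (j - p)) else 0)"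
  define X :: real where
    "X = (\<Sum>j\<le>q. fact m * fact k / (fact j * pochhammer (\<gamma> + 1) j * fact (m - j) * fact (k - j)))"
  have "c 0 = (\<Sum>j\<le>q. A j * (-1) ^ j)" by (simp add: c_def)
  also have "\<dots> = of_real X"
    unfolding X_def of_real_sum by (intro sum.cong refl) (simp add: A_def minus_one_power_iff)
  finally have "c 0 = of_real X" .
  moreover have "X > 0"
    unfolding X_def using assms by (intro sum_pos divide_pos_pos mult_pos_pos pochhammer_pos) auto
  ultimately show "c 0 \<noteq> 0" by simp
  fix z
  define w where "w = z * cnj z"
  have mono: "w ^ (j - p) * (z ^ (m - j) * cnj z ^ (k - j)) = z ^ (m - p) * cnj z ^ (k - p)"
    if "p \<le> j" "j \<le> q" for p j
  proof -
    have "m - p = (m - j) + (j - p)" "k - p = (k - j) + (j - p)"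
      using that by (auto simp: q_def)
    then show ?thesis by (simp only: w_def power_add power_mult_distrib mult_ac)
  qed
  have bin: "(1 - w) ^ j = (\<Sum>p\<le>j. of_nat (j choose p) * (-1) ^ (j - p) * w ^ (j - p))" for j
    using binomial_ring[of 1 "- w" j] power_minus[of w] by (simp add: mult.assoc)
  have "disc_poly \<gamma> m k z = (\<Sum>j\<le>q. A j * ((1 - w) ^ j * (z ^ (m - j) * cnj z ^ (k - j))))"
    unfolding disc_poly_explicit[OF assms] q_def[symmetric] w_def[symmetric] sum_distrib_left
    by (intro sum.cong) (simp_all add: A_def mult_ac)
  also have "\<dots> = (\<Sum>j\<le>q. \<Sum>p\<le>j. A j * (of_nat (j choose p) * (-1) ^ (j - p)) * (z ^ (m - p) * cnj z ^ (k - p)))"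
  proof (intro sum.cong refl)
    fix j assume "j \<in> {..q}"
    then have "(1 - w) ^ j * (z ^ (m - j) * cnj z ^ (k - j))
        = (\<Sum>p\<le>j. of_nat (j choose p) * (-1) ^ (j - p) * (z ^ (m - p) * cnj z ^ (k - p)))"
      unfolding bin sum_distrib_right
      by (intro sum.cong refl) (simp add: mult.assoc mono)
    then show "A j * ((1 - w) ^ j * (z ^ (m - j) * cnj z ^ (k - j)))
        = (\<Sum>p\<le>j. A j * (of_nat (j choose p) * (-1) ^ (j - p)) * (z ^ (m - p) * cnj z ^ (k - p)))"
      by (simp add: sum_distrib_left mult.assoc)
  qed
  also have "\<dots> = (\<Sum>j\<le>q. \<Sum>p\<le>q. if p \<le> j then
      A j * (of_nat (j choose p) * (-1) ^ (j - p)) * (z ^ (m - p) * cnj z ^ (k - p)) else 0)"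
    by (intro sum.cong refl sum.mono_neutral_cong_left) auto
  also have "\<dots> = (\<Sum>p\<le>q. \<Sum>j\<le>q. if p \<le> j then
      A j * (of_nat (j choose p) * (-1) ^ (j - p)) * (z ^ (m - p) * cnj z ^ (k - p)) else 0)"
    by (rule sum.swap)
  also have "\<dots> = (\<Sum>p\<le>q. c p * (z ^ (m - p) * cnj z ^ (k - p)))"
    unfolding c_def sum_distrib_right by (intro sum.cong refl) auto
  finally show "disc_poly \<gamma> m k z = (\<Sum>p\<le>min m k. c p * (z ^ (m - p) * cnj z ^ (k - p)))"
    unfolding q_def .
qed

lemma subspace_sum_fun:
  assumes "cfun.subspace S" "\<And>i. i \<in> A \<Longrightarrow> f i \<in> S"
  shows "(\<lambda>z. \<Sum>i\<in>A. c i * f i z) \<in> S"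
proof -
  have "(\<Sum>i\<in>A. cscale (c i) (f i)) \<in> S"
    using assms by (intro cfun.subspace_sum cfun.subspace_scale)
  also have "(\<Sum>i\<in>A. cscale (c i) (f i)) = (\<lambda>z. \<Sum>i\<in>A. c i * f i z)"
    by (induction A rule: infinite_finite_induct) (auto simp: cscale_def zero_fun_def plus_fun_def)
  finally show ?thesis .
qed

text \<open>The expansion is solved for its leading monomial, whose coefficient is nonzero. All
  other monomials have a smaller power of \<open>cnj z\<close>, so strong induction on
  \<open>k\<close> applies; \<open>m\<close> drops along with it and therefore stays
  arbitrary.\<close>

lemma monomial_in_span_disc_poly:
  assumes "\<gamma> > -1" "k \<le> n"
  shows "(\<lambda>z. z ^ m * cnj z ^ k) \<in> cfun.span {disc_poly \<gamma> m k | m k. k \<le> n}"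
  using assms(2)
proof (induction k arbitrary: m rule: less_induct)
  case (less k)
  let ?V = "cfun.span {disc_poly \<gamma> m k | m k. k \<le> n}"
  obtain c where c: "c 0 \<noteq> 0"
    "\<And>z. disc_poly \<gamma> m k z = (\<Sum>p\<le>min m k. c p * (z ^ (m - p) * cnj z ^ (k - p)))"
    using disc_poly_eq_sum_monomials[OF assms(1)] by metis
  define L where "L = (\<lambda>z. \<Sum>p\<in>{1..min m k}. c p * (z ^ (m - p) * cnj z ^ (k - p)))"
  have "L \<in> ?V"
    unfolding L_def using less by (intro subspace_sum_fun cfun.subspace_span) auto
  moreover have "disc_poly \<gamma> m k \<in> ?V" using less.prems by (intro cfun.span_base) blast
  ultimately have "cscale (1 / c 0) (disc_poly \<gamma> m k - L) \<in> ?V"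
    by (intro cfun.span_scale cfun.span_diff)
  also have "cscale (1 / c 0) (disc_poly \<gamma> m k - L) = (\<lambda>z. z ^ m * cnj z ^ k)"
  proof
    fix z
    have "{..min m k} = insert 0 {1..min m k}" by auto
    then have "disc_poly \<gamma> m k z = c 0 * (z ^ m * cnj z ^ k) + L z"
      unfolding c(2) L_def by simp
    then show "cscale (1 / c 0) (disc_poly \<gamma> m k - L) z = z ^ m * cnj z ^ k"
      using c(1) by (simp add: cscale_def)
  qed
  finally show ?case .
qed

section \<open>Density\<close>

text \<open>Indexing by pairs, with the exponent of \<open>cnj z\<close> first, turns truncation and
  separation of angular modes into operations on the index set. Over an infinite index set the sum
  is 0 by convention.\<close>

definition bipoly :: "(nat \<Rightarrow> nat \<Rightarrow> complex) \<Rightarrow> (nat \<times> nat) set \<Rightarrow> complex \<Rightarrow> complex" where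
  "bipoly a A z = (\<Sum>(j, m)\<in>A. a j m * (z ^ m * cnj z ^ j))"

lemma borel_measurable_bipoly [measurable]: "bipoly a A \<in> borel_measurable borel"
  unfolding bipoly_def[abs_def] case_prod_beta by measurable

lemma norm_bipoly_le:
  assumes "norm z \<le> 1"
  shows "norm (bipoly a A z) \<le> (\<Sum>(j, m)\<in>A. norm (a j m))"
  unfolding bipoly_def
proof (rule sum_norm_le, clarify)
  fix j m
  have "norm z ^ m * norm z ^ j \<le> 1"
    using assms by (simp add: power_le_one flip: power_add)
  then show "norm (a j m * (z ^ m * cnj z ^ j)) \<le> norm (a j m)"
    by (simp add: norm_mult norm_power mult_left_le)
qed

lemma bipoly_L2:
  assumes "\<gamma> > -1"
  shows "bipoly a A \<in> L2 \<gamma>"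
proof -
  have "integrable (\<mu> \<gamma>) (\<lambda>z. (norm (bipoly a A z))\<^sup>2)"
    by (rule integrable_disc_measure_bounded[OF assms, where B = "(\<Sum>(j, m)\<in>A. norm (a j m))\<^sup>2"])
      (auto intro!: power_mono norm_bipoly_le)
  then show ?thesis by (simp add: L2_def borel_measurable_disc_measure)
qed

text \<open>The hypothesis says that the modes \<open>m - j\<close> and \<open>m' - j'\<close>
  differ, written without subtraction on \<open>nat\<close>. Multiplied out, every term is a
  monomial of nonzero mode against a radial weight, the cutoff at \<open>R\<close> being radial
  too.\<close>

lemma integral_bipoly_orthogonal:
  assumes "\<gamma> > -1"
    and ne: "\<And>j m j' m'. (j, m) \<in> A \<Longrightarrow> (j', m') \<in> B \<Longrightarrow> m + j' \<noteq> m' + j"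
  shows "(\<integral>z. indicator (cball 0 R) z *\<^sub>R (bipoly a A z * cnj (bipoly b B z)) \<partial>\<mu> \<gamma>) = 0"
proof -
  define g where "g = (\<lambda>(j, m) (j', m') z. indicator (cball 0 R) z *\<^sub>R (z ^ (m + j') * cnj z ^ (m' + j)))"
  have g_meas [measurable]: "g p q \<in> borel_measurable borel" for p q
    unfolding g_def case_prod_beta by measurable
  have g_int: "integrable (\<mu> \<gamma>) (g p q)" for p q
    by (rule integrable_disc_measure_bounded[OF assms(1) g_meas, where B = 1])
      (auto simp: g_def case_prod_beta norm_mult norm_power indicator_def intro!: mult_le_one power_le_one)
  have g_0: "(\<integral>z. g p q z \<partial>\<mu> \<gamma>) = 0" if "p \<in> A" "q \<in> B" for p q
  proof -
    obtain j m j' m' where p: "p = (j, m)" "q = (j', m')" by fastforce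
    have "(\<integral>z. g p q z \<partial>\<mu> \<gamma>) = (\<integral>z. (disc_weight \<gamma> (norm z) * indicator {..R} (norm z)) *\<^sub>R
        (z ^ (m + j') * cnj z ^ (m' + j)) \<partial>lborel)"
      unfolding integral_disc_measure[OF g_meas]
      by (intro Bochner_Integration.integral_cong refl) (simp add: g_def p indicator_def)
    also have "\<dots> = 0"
      using ne that by (intro integral_lborel_radial_monomial) (auto simp: p)
    finally show ?thesis .
  qed
  have eq: "indicator (cball 0 R) z *\<^sub>R (bipoly a A z * cnj (bipoly b B z))
    = (\<Sum>p\<in>A. \<Sum>q\<in>B. (a (fst p) (snd p) * cnj (b (fst q) (snd q))) * g p q z)" for z
    by (simp add: bipoly_def case_prod_beta sum_product scaleR_sum_right g_def power_add mult_ac)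
  have "(\<integral>z. indicator (cball 0 R) z *\<^sub>R (bipoly a A z * cnj (bipoly b B z)) \<partial>\<mu> \<gamma>)
    = (\<Sum>p\<in>A. \<Sum>q\<in>B. (a (fst p) (snd p) * cnj (b (fst q) (snd q))) * (\<integral>z. g p q z \<partial>\<mu> \<gamma>))"
    unfolding eq using g_int by simp
  also have "\<dots> = 0" using g_0 by (intro sum.neutral ballI) simp
  finally show ?thesis .
qed

lemma bipoly_Pythagoras:
  assumes "\<gamma> > -1" "finite A" "finite B"
    and ne: "\<And>j m j' m'. (j, m) \<in> A \<Longrightarrow> (j', m') \<in> B \<Longrightarrow> m + j' \<noteq> m' + j"
  shows "(\<integral>z. indicator (cball 0 R) z * (norm (bipoly a (A \<union> B) z))\<^sup>2 \<partial>\<mu> \<gamma>) =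
    (\<integral>z. indicator (cball 0 R) z * (norm (bipoly a A z))\<^sup>2 \<partial>\<mu> \<gamma>) +
    (\<integral>z. indicator (cball 0 R) z * (norm (bipoly a B z))\<^sup>2 \<partial>\<mu> \<gamma>)"
proof -
  \<comment> \<open>A common pair would have to differ in mode from itself.\<close>
  have "A \<inter> B = {}" using ne by fastforce
  then have add: "bipoly a (A \<union> B) z = bipoly a A z + bipoly a B z" for z
    unfolding bipoly_def using assms(2,3) by (rule sum.union_disjoint[rotated 2])
  let ?I = "\<lambda>z. indicator (cball 0 R) z *\<^sub>R (bipoly a A z * cnj (bipoly a B z))"
  have sq: "(norm (x + y))\<^sup>2 = (norm x)\<^sup>2 + (norm y)\<^sup>2 + 2 * Re (x * cnj y)" for x y :: complex
    unfolding cmod_power2 by (simp add: power2_eq_square algebra_simps)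
  have int: "integrable (\<mu> \<gamma>) (\<lambda>z. indicator (cball 0 R) z * (norm (bipoly a C z))\<^sup>2)" for C
  proof (rule integrable_disc_measure_bounded[OF assms(1), where B = "(\<Sum>(j, m)\<in>C. norm (a j m))\<^sup>2"])
    show "norm (indicator (cball 0 R) z * (norm (bipoly a C z))\<^sup>2) \<le> (\<Sum>(j, m)\<in>C. norm (a j m))\<^sup>2"
      if "norm z < 1" for z
      using that norm_bipoly_le[of z a C] by (auto simp: indicator_def intro!: power_mono)
  qed measurable
  have intI: "integrable (\<mu> \<gamma>) ?I"
  proof (rule integrable_disc_measure_bounded[OF assms(1), where B =
      "(\<Sum>(j, m)\<in>A. norm (a j m)) * (\<Sum>(j, m)\<in>B. norm (a j m))"])
    show "?I \<in> borel_measurable borel" by measurable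
    show "norm (?I z) \<le> (\<Sum>(j, m)\<in>A. norm (a j m)) * (\<Sum>(j, m)\<in>B. norm (a j m))" if "norm z < 1" for z
    proof -
      have "norm (bipoly a A z * cnj (bipoly a B z)) \<le> (\<Sum>(j, m)\<in>A. norm (a j m)) * (\<Sum>(j, m)\<in>B. norm (a j m))"
        using that unfolding norm_mult complex_mod_cnj
        by (intro mult_mono norm_bipoly_le sum_nonneg) auto
      then show ?thesis using order_trans[OF norm_ge_zero] by (auto simp: indicator_def)
    qed
  qed
  have "(\<integral>z. indicator (cball 0 R) z * (norm (bipoly a (A \<union> B) z))\<^sup>2 \<partial>\<mu> \<gamma>) =
    (\<integral>z. indicator (cball 0 R) z * (norm (bipoly a A z))\<^sup>2
      + indicator (cball 0 R) z * (norm (bipoly a B z))\<^sup>2 + 2 * Re (?I z) \<partial>\<mu> \<gamma>)"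
    unfolding add sq by (intro Bochner_Integration.integral_cong refl) (simp add: indicator_def)
  also have "\<dots> = (\<integral>z. indicator (cball 0 R) z * (norm (bipoly a A z))\<^sup>2 \<partial>\<mu> \<gamma>) +
    (\<integral>z. indicator (cball 0 R) z * (norm (bipoly a B z))\<^sup>2 \<partial>\<mu> \<gamma>) + 2 * Re (\<integral>z. ?I z \<partial>\<mu> \<gamma>)"
    using int[of A] int[of B] intI by (simp only: Bochner_Integration.integral_add
      Bochner_Integration.integrable_add integrable_mult_right integrable_Re
      integral_mult_right_zero integral_Re)
  also have "(\<integral>z. ?I z \<partial>\<mu> \<gamma>) = 0" using assms(1) ne by (rule integral_bipoly_orthogonal)
  finally show ?thesis by simp
qed

lemma bipoly_diff:
  assumes "finite B" "A \<subseteq> B"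
  shows "bipoly a (B - A) = bipoly a B - bipoly a A"
  by (rule ext) (simp add: bipoly_def sum_diff[OF assms])

lemma cnj_poly_L2_approx:
  assumes \<gamma>: "\<gamma> > -1" and hol: "\<And>j. j < k \<Longrightarrow> \<phi> j holomorphic_on \<D>"
    and L2: "cnj_poly k \<phi> \<in> L2 \<gamma>" and e: "e > 0"
  obtains a N where "L2_norm \<gamma> (cnj_poly k \<phi> - bipoly a (Sigma {..<k} (\<lambda>j. {..N + j}))) < e"
proof -
  interpret finite_measure "\<mu> \<gamma>" by (rule finite_disc_measure[OF \<gamma>])
  define F where "F = cnj_poly k \<phi>"
  have F: "F \<in> L2 \<gamma>" using L2 by (simp add: F_def)
  have F_meas [measurable]: "F \<in> borel_measurable (\<mu> \<gamma>)" using F by (simp add: L2_def)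
  have "\<forall>j. \<exists>b. j < k \<longrightarrow> (\<forall>z. norm z < 1 \<longrightarrow> (\<lambda>m. b m * z ^ m) sums \<phi> j z) \<and>
      (\<forall>r. 0 \<le> r \<longrightarrow> r < 1 \<longrightarrow> summable (\<lambda>m. norm (b m) * r ^ m))"
    using holomorphic_ball_taylor[OF hol] by metis
  then obtain a where sums: "\<And>j z. j < k \<Longrightarrow> norm z < 1 \<Longrightarrow> (\<lambda>m. a j m * z ^ m) sums \<phi> j z"
    and summable: "\<And>j r. j < k \<Longrightarrow> 0 \<le> r \<Longrightarrow> r < 1 \<Longrightarrow> summable (\<lambda>m. norm (a j m) * r ^ m)"
    by metis
  \<comment> \<open>The bound \<open>m \<le> N + j\<close> is \<open>m - j \<le> N\<close> for the
    mode, so pairs added after stage \<open>N\<close> have modes above \<open>N\<close> and are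
    orthogonal to all earlier ones.\<close>
  define A where "A = (\<lambda>N. Sigma {..<k} (\<lambda>j. {..N + j}))"
  define S where "S = (\<lambda>N. bipoly a (A N))"
  have fin: "finite (A N)" for N by (simp add: A_def)
  have A_mono: "A N \<subseteq> A M" if "N \<le> M" for N M using that by (auto simp: A_def)
  have S_L2: "S N \<in> L2 \<gamma>" for N unfolding S_def by (rule bipoly_L2[OF \<gamma>])
  then have S_meas [measurable]: "S N \<in> borel_measurable (\<mu> \<gamma>)" for N by (simp add: L2_def)
  have I_meas [measurable]: "(\<lambda>z. indicator (cball 0 R) z :: real) \<in> borel_measurable (\<mu> \<gamma>)" for R
    by (intro borel_measurable_disc_measure borel_measurable_indicator) simp
  have S_eq: "S N z = (\<Sum>j<k. cnj z ^ j * (\<Sum>m<N + Suc j. a j m * z ^ m))" for N z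
    unfolding S_def A_def bipoly_def
    by (subst sum.Sigma[symmetric]) (simp_all add: sum_distrib_left mult_ac lessThan_Suc_atMost)
  have lim: "(\<lambda>N. S N z) \<longlonglongrightarrow> F z" if "norm z < 1" for z
    unfolding S_eq F_def cnj_poly_def
  proof (intro tendsto_sum tendsto_mult tendsto_const)
    fix j assume "j \<in> {..<k}"
    then have "(\<lambda>N. \<Sum>m<N. a j m * z ^ m) \<longlonglongrightarrow> \<phi> j z" using sums[of j z] that by (simp add: sums_def)
    then show "(\<lambda>N. \<Sum>m<N + Suc j. a j m * z ^ m) \<longlonglongrightarrow> \<phi> j z" by (rule LIMSEQ_ignore_initial_segment)
  qed
  have bound: "norm (S N z) \<le> (\<Sum>j<k. \<Sum>m. norm (a j m) * R ^ m)" if R: "norm z \<le> R" "R < 1" for N z R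
    unfolding S_eq
  proof (rule sum_norm_le)
    fix j assume j: "j \<in> {..<k}"
    have R0: "0 \<le> R" using R norm_ge_zero[of z] by linarith
    have "norm (cnj z ^ j * (\<Sum>m<N + Suc j. a j m * z ^ m)) \<le> 1 * norm (\<Sum>m<N + Suc j. a j m * z ^ m)"
      unfolding norm_mult norm_power complex_mod_cnj
      using R by (intro mult_right_mono power_le_one) auto
    also have "\<dots> \<le> (\<Sum>m<N + Suc j. norm (a j m) * R ^ m)"
      unfolding mult_1 using R by (intro sum_norm_le) (simp add: norm_mult norm_power mult_left_mono power_mono)
    also have "\<dots> \<le> (\<Sum>m. norm (a j m) * R ^ m)"
      using summable[of j R] R R0 j by (intro sum_le_suminf) auto
    finally show "norm (cnj z ^ j * (\<Sum>m<N + Suc j. a j m * z ^ m)) \<le> (\<Sum>m. norm (a j m) * R ^ m)" .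
  qed
  define q where "q = (\<lambda>R (f :: complex \<Rightarrow> complex). \<integral>z. indicator (cball 0 R) z * (norm (f z))\<^sup>2 \<partial>\<mu> \<gamma>)"
  have q_1: "q 1 f = (L2_norm \<gamma> f)\<^sup>2" for f
    unfolding q_def L2_norm_power2
    by (intro Bochner_Integration.integral_cong refl) (simp add: space_disc_measure)
  have pyth: "q R (S M) = q R (S N) + q R (S M - S N)" if "N \<le> M" for R N M
  proof -
    have "A N \<union> (A M - A N) = A M" using A_mono[OF that] by auto
    moreover have "S M - S N = bipoly a (A M - A N)"
      using bipoly_diff[OF fin A_mono[OF that]] by (simp add: S_def)
    moreover have "m + j' \<noteq> m' + j" if "(j, m) \<in> A N" "(j', m') \<in> A M - A N" for j m j' m'
      using that by (auto simp: A_def)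
    ultimately show ?thesis
      using bipoly_Pythagoras[OF \<gamma> fin[of N], of "A M - A N" R a] fin[of M] by (simp add: q_def S_def)
  qed
  have q_nonneg: "q R f \<ge> 0" for R f unfolding q_def by (intro integral_nonneg_AE) auto
  have q_le: "q R f \<le> (L2_norm \<gamma> f)\<^sup>2" if "f \<in> L2 \<gamma>" for R f
    unfolding q_def L2_norm_power2 using that
    by (intro integral_mono') (auto simp: L2_def indicator_def)
  \<comment> \<open>The Taylor series give a uniform bound on the truncations only below radius 1.
    There dominated convergence yields the limit \<open>q R F\<close>, which by orthogonality is
    approached from below.\<close>
  have q_S_F: "q R (S N) \<le> (L2_norm \<gamma> F)\<^sup>2" if R: "R < 1" for R N
  proof -
    let ?B = "(\<Sum>j<k. \<Sum>m. norm (a j m) * R ^ m)\<^sup>2"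
    have "(\<lambda>M. q R (S M)) \<longlonglongrightarrow> q R F"
      unfolding q_def
    proof (rule integral_dominated_convergence)
      show "integrable (\<mu> \<gamma>) (\<lambda>z. ?B)" by simp
      show "AE z in \<mu> \<gamma>. (\<lambda>M. indicator (cball 0 R) z * (norm (S M z))\<^sup>2)
          \<longlonglongrightarrow> indicator (cball 0 R) z * (norm (F z))\<^sup>2"
        using lim by (intro AE_I2 tendsto_intros) (simp add: space_disc_measure)
      show "AE z in \<mu> \<gamma>. norm (indicator (cball 0 R) z * (norm (S M z))\<^sup>2) \<le> ?B" for M
        using bound[OF _ R] by (intro AE_I2) (auto simp: indicator_def intro!: power_mono)
    qed measurable
    moreover have "q R (S N) \<le> q R (S M)" if "N \<le> M" for M
      using pyth[OF that, of R] q_nonneg[of R "S M - S N"] by simp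
    ultimately have "q R (S N) \<le> q R F" by (intro LIMSEQ_le_const) auto
    then show ?thesis using q_le[OF F, of R] by linarith
  qed
  \<comment> \<open>With the truncation fixed, the radius tends to 1 along
    \<open>1 - 1 / (i + 1)\<close>; the bound by \<open>F\<close> is uniform in the radius and so
    passes to the full norm.\<close>
  have S_F: "(L2_norm \<gamma> (S N))\<^sup>2 \<le> (L2_norm \<gamma> F)\<^sup>2" for N
  proof -
    have "(\<lambda>i. q (1 - inverse (real (Suc i))) (S N)) \<longlonglongrightarrow> q 1 (S N)"
      unfolding q_def
    proof (rule integral_dominated_convergence)
      show "integrable (\<mu> \<gamma>) (\<lambda>z. (norm (S N z))\<^sup>2)" using S_L2[of N] by (simp add: L2_def)
      have "(\<lambda>i. indicator (cball 0 (1 - inverse (real (Suc i)))) z :: real) \<longlonglongrightarrow> indicator (cball 0 1) z"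
        if z: "norm z < 1" for z :: complex
      proof (rule tendsto_eventually)
        have "eventually (\<lambda>i. inverse (real (Suc i)) < 1 - norm z) sequentially"
          using order_tendstoD(2)[OF LIMSEQ_inverse_real_of_nat] z by simp
        then show "eventually (\<lambda>i. (indicator (cball 0 (1 - inverse (real (Suc i)))) z :: real) =
            indicator (cball 0 1) z) sequentially"
          by eventually_elim (use z in \<open>simp add: indicator_def\<close>)
      qed
      then show "AE z in \<mu> \<gamma>. (\<lambda>i. indicator (cball 0 (1 - inverse (real (Suc i)))) z * (norm (S N z))\<^sup>2)
          \<longlonglongrightarrow> indicator (cball 0 1) z * (norm (S N z))\<^sup>2"
        by (intro AE_I2 tendsto_mult tendsto_const) (simp add: space_disc_measure)
      show "AE z in \<mu> \<gamma>. norm (indicator (cball 0 (1 - inverse (real (Suc i)))) z * (norm (S N z))\<^sup>2)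
          \<le> (norm (S N z))\<^sup>2" for i
        by (intro AE_I2) (auto simp: indicator_def)
    qed measurable
    then have "q 1 (S N) \<le> (L2_norm \<gamma> F)\<^sup>2"
      by (rule LIMSEQ_le_const2) (auto intro!: q_S_F)
    then show ?thesis by (simp only: q_1)
  qed
  \<comment> \<open>By orthogonality the squared distances between truncations are differences of
    \<open>l\<close>, so convergence of this bounded increasing sequence is the Cauchy
    property.\<close>
  define l where "l = (\<lambda>N. (L2_norm \<gamma> (S N))\<^sup>2)"
  have l_diff: "(L2_norm \<gamma> (S M - S N))\<^sup>2 = l M - l N" if "N \<le> M" for N M
    using pyth[OF that, of 1] by (simp add: q_1 l_def)
  have "incseq l"
    unfolding incseq_def using l_diff by (metis diff_ge_0_iff_ge zero_le_power2)
  then obtain L where L: "l \<longlonglongrightarrow> L" "\<And>N. l N \<le> L"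
    using incseq_convergent[of l "(L2_norm \<gamma> F)\<^sup>2"] S_F unfolding l_def by metis
  have "eventually (\<lambda>N. l N > L - e\<^sup>2) sequentially"
    using e by (intro order_tendstoD(1)[OF L(1)]) simp
  then obtain N where N: "l N > L - e\<^sup>2" by (auto simp: eventually_sequentially)
  \<comment> \<open>Fatou's lemma in \<open>M\<close> with \<open>N\<close> fixed:
    \<open>S M - S N\<close> tends to \<open>F - S N\<close>, and its squared norm never exceeds the
    remaining gap \<open>L - l N\<close>.\<close>
  have "L2_norm \<gamma> (F - S N) \<le> sqrt (L - l N)"
  proof (rule L2_norm_Fatou(2))
    show "S M - S N \<in> L2 \<gamma>" for M using S_L2 by (intro L2_diff)
    show "F - S N \<in> borel_measurable (\<mu> \<gamma>)" using L2_diff[OF F S_L2[of N]] by (simp add: L2_def)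
    show "AE z in \<mu> \<gamma>. (\<lambda>M. (S M - S N) z) \<longlonglongrightarrow> (F - S N) z"
      using lim by (intro AE_I2) (auto simp: space_disc_measure intro!: tendsto_intros)
    have "L2_norm \<gamma> (S M - S N) \<le> sqrt (L - l N)" if "N \<le> M" for M
      using l_diff[OF that] L(2)[of M] by (intro real_le_rsqrt) simp
    then show "eventually (\<lambda>M. L2_norm \<gamma> (S M - S N) \<le> sqrt (L - l N)) sequentially"
      by (auto simp: eventually_sequentially)
  qed
  also have "\<dots> < sqrt (e\<^sup>2)" using N by (intro real_sqrt_less_mono) simp
  finally have "L2_norm \<gamma> (F - S N) < e" using e by simp
  then show thesis by (intro that[of a N]) (simp add: F_def S_def A_def)
qed

lemma monomial_in_poly_bergman:
  assumes "\<gamma> > -1" "k \<le> n"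
  shows "(\<lambda>z. z ^ m * cnj z ^ k) \<in> poly_bergman \<gamma> n"
proof -
  have "bipoly (\<lambda>_ _. 1) {(k, m)} \<in> L2 \<gamma>" by (rule bipoly_L2[OF assms(1)])
  then have "(\<lambda>z. z ^ m * cnj z ^ k) \<in> L2 \<gamma>" by (simp add: bipoly_def[abs_def])
  moreover have "cnj_poly (Suc n) (\<lambda>j z. if j = k then z ^ m else 0) z = z ^ m * cnj z ^ k" for z
  proof -
    have "cnj_poly (Suc n) (\<lambda>j z. if j = k then z ^ m else 0) z
        = (\<Sum>j<Suc n. if j = k then cnj z ^ k * z ^ m else 0)"
      unfolding cnj_poly_def by (intro sum.cong) auto
    then show ?thesis using assms(2) by (simp add: mult.commute del: sum.lessThan_Suc)
  qed
  moreover have "(\<lambda>z. if j = k then z ^ m else 0) holomorphic_on \<D>" for j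
    by (cases "j = k") (auto intro!: holomorphic_intros)
  ultimately show ?thesis
    unfolding poly_bergman_iff by (intro conjI exI[of _ "\<lambda>j z. if j = k then z ^ m else 0"]) auto
qed

lemma disc_poly_in_poly_bergman:
  assumes "\<gamma> > -1" "k \<le> n"
  shows "disc_poly \<gamma> m k \<in> poly_bergman \<gamma> n"
proof -
  obtain c where "\<And>z. disc_poly \<gamma> m k z = (\<Sum>p\<le>min m k. c p * (z ^ (m - p) * cnj z ^ (k - p)))"
    using disc_poly_eq_sum_monomials[OF assms(1)] by metis
  then have "disc_poly \<gamma> m k = (\<lambda>z. \<Sum>p\<le>min m k. c p * (z ^ (m - p) * cnj z ^ (k - p)))"
    by (rule ext)
  also have "\<dots> \<in> poly_bergman \<gamma> n"
    using assms by (intro subspace_sum_fun subspace_poly_bergman monomial_in_poly_bergman) auto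
  finally show ?thesis .
qed

lemma poly_bergman_subset_closure_of_span:
  assumes "\<gamma> > -1"
  shows "poly_bergman \<gamma> n \<subseteq> L2_topology \<gamma> closure_of cfun.span {disc_poly \<gamma> m k | m k. k \<le> n}"
proof
  fix F assume "F \<in> poly_bergman \<gamma> n"
  then obtain \<phi> where F: "F \<in> L2 \<gamma>" and hol: "\<And>j. j < Suc n \<Longrightarrow> \<phi> j holomorphic_on \<D>"
    and AE: "AE z in \<mu> \<gamma>. F z = cnj_poly (Suc n) \<phi> z"
    unfolding poly_bergman_iff by blast
  have L2: "cnj_poly (Suc n) \<phi> \<in> L2 \<gamma>"
    by (rule L2_cong_AE(1)[OF F borel_measurable_disc_measure_continuous[OF continuous_on_cnj_poly[OF hol]] AE])
  have "\<exists>g\<in>cfun.span {disc_poly \<gamma> m k | m k. k \<le> n}. g \<in> L2 \<gamma> \<and> L2_norm \<gamma> (g - F) < e" if e: "e > 0" for e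
  proof -
    obtain a N where aN: "L2_norm \<gamma> (cnj_poly (Suc n) \<phi> - bipoly a (Sigma {..<Suc n} (\<lambda>j. {..N + j}))) < e"
      using cnj_poly_L2_approx[OF assms hol L2 e] by metis
    define g where "g = bipoly a (Sigma {..<Suc n} (\<lambda>j. {..N + j}))"
    have g: "g \<in> L2 \<gamma>" unfolding g_def by (rule bipoly_L2[OF assms])
    have "g = (\<lambda>z. \<Sum>p\<in>Sigma {..<Suc n} (\<lambda>j. {..N + j}). a (fst p) (snd p) * (z ^ snd p * cnj z ^ fst p))"
      unfolding g_def bipoly_def[abs_def] case_prod_beta ..
    also have "\<dots> \<in> cfun.span {disc_poly \<gamma> m k | m k. k \<le> n}"
      by (intro subspace_sum_fun cfun.subspace_span monomial_in_span_disc_poly[OF assms]) auto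
    finally have "g \<in> cfun.span {disc_poly \<gamma> m k | m k. k \<le> n}" .
    \<comment> \<open>The approximation was made for the representative; returning to
      \<open>F\<close> changes only a null set.\<close>
    moreover have "AE z in \<mu> \<gamma>. (cnj_poly (Suc n) \<phi> - g) z = (F - g) z"
      using AE by eventually_elim simp
    then have "L2_norm \<gamma> (F - g) = L2_norm \<gamma> (cnj_poly (Suc n) \<phi> - g)"
      using L2_cong_AE(2)[OF L2_diff[OF L2 g]] L2_diff[OF F g] by (simp add: L2_def)
    ultimately show ?thesis using aN g by (auto simp: g_def L2_norm_minus_commute[of \<gamma> _ F])
  qed
  with F show "F \<in> L2_topology \<gamma> closure_of cfun.span {disc_poly \<gamma> m k | m k. k \<le> n}"
    unfolding L2_topology_closure_of by blast
qed

theorem theorem1p1: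
  fixes \<gamma> :: real and n :: nat
  assumes "\<gamma> > -1"
  shows "cfun.subspace (poly_bergman \<gamma> n) \<and>
         closedin (L2_topology \<gamma>) (poly_bergman \<gamma> n) \<and>
         {disc_poly \<gamma> m k | m k. k \<le> n} \<subseteq> L2 \<gamma> \<and>
         poly_bergman \<gamma> n =
           L2_topology \<gamma> closure_of cfun.span {disc_poly \<gamma> m k | m k. k \<le> n}"
proof -
  let ?D = "{disc_poly \<gamma> m k | m k. k \<le> n}"
  have D: "?D \<subseteq> poly_bergman \<gamma> n"
    using disc_poly_in_poly_bergman[OF assms] by blast
  moreover have "poly_bergman \<gamma> n \<subseteq> L2 \<gamma>" by (auto simp: poly_bergman_def)
  \<comment> \<open>\<open>closure_of\<close> disregards points outside the topspace, so this
    inclusion guarantees that no disc polynomial is silently dropped.\<close>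
  ultimately have "?D \<subseteq> L2 \<gamma>" by (rule order_trans)
  moreover have "cfun.span ?D \<subseteq> poly_bergman \<gamma> n"
    using D subspace_poly_bergman by (rule cfun.span_minimal)
  then have "L2_topology \<gamma> closure_of cfun.span ?D \<subseteq> poly_bergman \<gamma> n"
    using closure_of_mono closure_of_poly_bergman_subset[OF assms] by (meson order_trans)
  ultimately show ?thesis
    using subspace_poly_bergman closedin_poly_bergman[OF assms]
      poly_bergman_subset_closure_of_span[OF assms] by blast
qed

end
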